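(* Let $W_0:\mathbb{R}^d\times\mathcal{P}_2(\mathbb{R}^d)\to\mathbb{R}^d$ and $F,G:\mathbb{R}^d\times\mathcal{P}_2(\mathbb{R}^d)\times\mathbb{R}^d\to\mathbb{R}^d$ be continuous. Assume: (1) there is a constant $C_1$ with $|W_0(x,\mu)|+|F(x,\mu,u)|+|G(x,\mu,u)|\le C_1(1+|x|+|u|+\sqrt{E_2(\mu)})$ for all $(x,\mu,u)$; (2) there exist $\alpha>0$, $L\ge0$, $a_0>0$ such that for all $X,Y,U,V\in\mathcal{H}$: $\langle\tilde W_0(X)-\tilde W_0(Y),X-Y\rangle\ge a_0\|\tilde W_0(X)-\tilde W_0(Y)\|^2$; $\langle\tilde G(X,U)-\tilde G(Y,V),X-Y\rangle+\langle\tilde F(X,U)-\tilde F(Y,V),U-V\rangle\ge0$; $\langle\tilde G(X,U)-\tilde G(Y,V),X-Y\rangle+\langle\tilde F(X,U)-\tilde F(Y,V),U-V\rangle\ge\alpha\|X-Y\|^2-L\|U-V\|^2$. Suppose that for some initial datum $X_0\in\mathcal{H}$ there exists a strong solution $(X_t,W_t,Z_t)_{t\in[0,T]}$ of $$X_t=X_0-\int_0^t\tilde F(X_s,W_s)ds+\sigma_xB_t,\qquad W_t=\tilde W_0(X_T)+\int_t^T\tilde G(X_s,W_s)ds-\int_t^TZ_sdB_s.$$ Then there exists a constant $C$, depending only on $a_0,\alpha,L,T$ and the growth constant of $(F,G,W_0)$ (for the given $d$ and $\sigma_x$), such that for all $0\le s<t\le T$, $$\|X_t\|\le C(1+\|X_0\|),\quad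 \|W_t\|\le C(1+\|X_0\|),\quad \frac{\|X_t-X_s\|}{\sqrt{t-s}}\le C(1+\|X_0\|).$$
   Context: Fix $d\ge1$, $T>0$, $\sigma_x\ge0$ and a sufficiently rich probability space. $\mathcal{H}=L^2(\Omega,\mathbb{R}^d)$ with $\langle X,Y\rangle=\mathbb{E}[X\cdot Y]$, norm $\|\cdot\|$; $\mathcal{L}(X)$ is the law of $X$; $\mathcal{P}_2(\mathbb{R}^d)$ carries $\mathcal{W}_2$; $E_2(\mu)=\int|y|^2\mu(dy)$. Lifts: $\tilde W_0(X)=W_0(X,\mathcal{L}(X))$, $\tilde F(X,U)=F(X,\mathcal{L}(X),U)$, $\tilde G(X,U)=G(X,\mathcal{L}(X),U)$. $B$ is a $d$-dimensional Brownian motion with respect to a filtration for which $X_0$ is measurable at time $0$ (so $X_0$ is independent of $B$). A strong solution is a triple of adapted, square integrable processes (with $X_t,W_t\in\mathcal{H}$ and $Z$ square integrable with respect to $dt\otimes\mathbb{P}$) satisfying the system. *)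

theory Defs
  imports "HOL-Probability.Probability"
begin

section \<open>Square integrable functions and the Wasserstein space\<close>

text \<open>Elements of $L^2$ are represented by functions; \<open>L2norm\<close> and \<open>L2inner\<close> do not see the
  choice of representative.  Both are used for $L^2(\Omega)$ and for $L^2(dt\otimes P)$.\<close>

definition L2 :: "'w measure \<Rightarrow> ('w \<Rightarrow> 'b::euclidean_space) set" where
  "L2 N = {X \<in> borel_measurable N. integrable N (\<lambda>w. (norm (X w))\<^sup>2)}"

definition L2norm :: "'w measure \<Rightarrow> ('w \<Rightarrow> 'b::euclidean_space) \<Rightarrow> real" where
  "L2norm N X = sqrt (\<integral>w. (norm (X w))\<^sup>2 \<partial>N)"

definition L2inner :: "'w measure \<Rightarrow> ('w \<Rightarrow> 'b::euclidean_space) \<Rightarrow> ('w \<Rightarrow> 'b) \<Rightarrow> real" where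
  "L2inner N X Y = (\<integral>w. X w \<bullet> Y w \<partial>N)"

definition law :: "'w measure \<Rightarrow> ('w \<Rightarrow> 'b::euclidean_space) \<Rightarrow> 'b measure" where
  "law M X = distr M borel X"

definition P2 :: "'b::euclidean_space measure set" where
  "P2 = {\<mu>. prob_space \<mu> \<and> sets \<mu> = sets borel \<and> integrable \<mu> (\<lambda>y. (norm y)\<^sup>2)}"

definition E2 :: "'b::euclidean_space measure \<Rightarrow> real" where
  "E2 \<mu> = (\<integral>y. (norm y)\<^sup>2 \<partial>\<mu>)"

definition couplings :: "'b::euclidean_space measure \<Rightarrow> 'b measure \<Rightarrow> ('b \<times> 'b) measure set" where
  "couplings \<mu> \<nu> = {\<pi>. prob_space \<pi> \<and> sets \<pi> = sets borel \<and>
     distr \<pi> borel fst = \<mu> \<and> distr \<pi> borel snd = \<nu>}"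

definition W2 :: "'b::euclidean_space measure \<Rightarrow> 'b measure \<Rightarrow> real" where
  "W2 \<mu> \<nu> = sqrt (INF \<pi>\<in>couplings \<mu> \<nu>. \<integral>p. (norm (fst p - snd p))\<^sup>2 \<partial>\<pi>)"

text \<open>Continuity on $E \times \mathcal{P}_2$, the second factor metrised by \<open>W2\<close>.  A coefficient
  is a total function on measures; nothing is required of it off \<open>P2\<close>.\<close>

definition W2_continuous ::
    "('e::metric_space \<Rightarrow> 'b::euclidean_space measure \<Rightarrow> 'c::metric_space) \<Rightarrow> bool" where
  "W2_continuous f \<longleftrightarrow>
     (\<forall>x. \<forall>\<mu>\<in>P2. \<forall>\<epsilon>>0. \<exists>\<delta>>0. \<forall>y. \<forall>\<nu>\<in>P2.
        dist y x < \<delta> \<and> W2 \<nu> \<mu> < \<delta> \<longrightarrow> dist (f y \<nu>) (f x \<mu>) < \<epsilon>)"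

definition lift1 :: "'w measure \<Rightarrow> ('b::euclidean_space \<Rightarrow> 'b measure \<Rightarrow> 'b) \<Rightarrow>
    ('w \<Rightarrow> 'b) \<Rightarrow> 'w \<Rightarrow> 'b" where
  "lift1 M H X = (\<lambda>w. H (X w) (law M X))"

definition lift2 :: "'w measure \<Rightarrow> ('b::euclidean_space \<Rightarrow> 'b measure \<Rightarrow> 'b \<Rightarrow> 'b) \<Rightarrow>
    ('w \<Rightarrow> 'b) \<Rightarrow> ('w \<Rightarrow> 'b) \<Rightarrow> 'w \<Rightarrow> 'b" where
  "lift2 M H X U = (\<lambda>w. H (X w) (law M X) (U w))"

section \<open>Brownian motion and the stochastic integral\<close>

text \<open>A sufficiently rich space carries a uniform variable, so that every Borel probability on a
  Euclidean space is a law on it.\<close>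

definition rich_space :: "'w measure \<Rightarrow> bool" where
  "rich_space M \<longleftrightarrow>
     (\<exists>U \<in> borel_measurable M. distr M borel U = uniform_measure lborel {0..1::real})"

text \<open>Only the times in $[0,T]$ matter.  The index type of the filtration is all of \<open>real\<close>; a
  filtration on $[0,T]$ extends to it as a constant on either side.\<close>

locale brownian_motion = prob_space M + filtration "space M" Fil
  for M :: "'w measure" and Fil :: "real \<Rightarrow> 'w measure" +
  fixes T :: real and B :: "real \<Rightarrow> 'w \<Rightarrow> real ^ 'n"
  assumes Fil_sub: "sets (Fil t) \<subseteq> sets M"
    and B_adapted: "t \<in> {0..T} \<Longrightarrow> B t \<in> borel_measurable (Fil t)"
    and B_zero: "AE w in M. B 0 w = 0"
    and B_continuous: "AE w in M. continuous_on {0..T} (\<lambda>t. B t w)"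
    and B_increment_indep: "0 \<le> s \<Longrightarrow> s < t \<Longrightarrow> t \<le> T \<Longrightarrow>
      indep_set (sets (Fil s)) {(\<lambda>w. B t w - B s w) -` A \<inter> space M | A. A \<in> sets borel}"
    and B_increment_normal: "0 \<le> s \<Longrightarrow> s < t \<Longrightarrow> t \<le> T \<Longrightarrow>
      distributed M lborel (\<lambda>w. B t w - B s w)
        (\<lambda>x. ennreal (\<Prod>i\<in>UNIV. normal_density 0 (sqrt (t - s)) (x $ i)))"

definition time_prod :: "real set \<Rightarrow> 'w measure \<Rightarrow> (real \<times> 'w) measure" where
  "time_prod I M = restrict_space lborel I \<Otimes>\<^sub>M M"

text \<open>A bounded elementary integrand on $[a,b]$ is given by a partition
  $a = \tau_0 \le \dots \le \tau_m = b$ and its values $\xi_i$ on $(\tau_i, \tau_{i+1}]$.\<close>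

definition elementary :: "'w measure \<Rightarrow> (real \<Rightarrow> 'w measure) \<Rightarrow> real \<Rightarrow> real \<Rightarrow>
    nat \<Rightarrow> (nat \<Rightarrow> real) \<Rightarrow> (nat \<Rightarrow> 'w \<Rightarrow> real ^ 'n ^ 'n) \<Rightarrow> bool" where
  "elementary M Fil a b m \<tau> \<xi> \<longleftrightarrow>
     \<tau> 0 = a \<and> \<tau> m = b \<and>
     (\<forall>i<m. \<tau> i \<le> \<tau> (Suc i) \<and> \<xi> i \<in> borel_measurable (Fil (\<tau> i)) \<and> bounded (\<xi> i ` space M))"

definition elementary_process ::
    "nat \<Rightarrow> (nat \<Rightarrow> real) \<Rightarrow> (nat \<Rightarrow> 'w \<Rightarrow> real ^ 'n ^ 'n) \<Rightarrow> real \<Rightarrow> 'w \<Rightarrow> real ^ 'n ^ 'n" where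
  "elementary_process m \<tau> \<xi> s w = (\<Sum>i<m. indicator {\<tau> i <.. \<tau> (Suc i)} s *\<^sub>R \<xi> i w)"

definition elementary_integral :: "(real \<Rightarrow> 'w \<Rightarrow> real ^ 'n) \<Rightarrow>
    nat \<Rightarrow> (nat \<Rightarrow> real) \<Rightarrow> (nat \<Rightarrow> 'w \<Rightarrow> real ^ 'n ^ 'n) \<Rightarrow> 'w \<Rightarrow> real ^ 'n" where
  "elementary_integral B m \<tau> \<xi> w = (\<Sum>i<m. \<xi> i w *v (B (\<tau> (Suc i)) w - B (\<tau> i) w))"

text \<open>\<open>I\<close> is a version of the It\^o integral of \<open>Z\<close> over $[a,b]$: the $L^2$-limit of the integrals of
  elementary integrands converging to \<open>Z\<close> in $L^2(dt\otimes P)$.  By the It\^o isometry \<open>I\<close> is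
  determined up to null sets.  The norm on matrices is the Frobenius norm.\<close>

definition has_ito_integral :: "'w measure \<Rightarrow> (real \<Rightarrow> 'w measure) \<Rightarrow>
    (real \<Rightarrow> 'w \<Rightarrow> real ^ 'n) \<Rightarrow> real \<Rightarrow> real \<Rightarrow>
    (real \<Rightarrow> 'w \<Rightarrow> real ^ 'n ^ 'n) \<Rightarrow> ('w \<Rightarrow> real ^ 'n) \<Rightarrow> bool" where
  "has_ito_integral M Fil B a b Z I \<longleftrightarrow>
     case_prod Z \<in> L2 (time_prod {a..b} M) \<and> I \<in> L2 M \<and>
     (\<exists>m \<tau> \<xi>.
        (\<forall>k. elementary M Fil a b (m k) (\<tau> k) (\<xi> k)) \<and>
        (\<lambda>k. L2norm (time_prod {a..b} M)
           (\<lambda>(s, w). Z s w - elementary_process (m k) (\<tau> k) (\<xi> k) s w)) \<longlonglongrightarrow> 0 \<and>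
        (\<lambda>k. L2norm M (\<lambda>w. I w - elementary_integral B (m k) (\<tau> k) (\<xi> k) w)) \<longlonglongrightarrow> 0)"

section \<open>The forward-backward system\<close>

text \<open>Each equation holds almost surely for each time; no path continuity is imposed.  The joint
  integrability of the two drifts is what makes the time integrals genuine.  It follows from the
  square integrability of \<open>X\<close> and \<open>W\<close> when the coefficients are continuous of linear growth.\<close>

definition strong_solution :: "'w measure \<Rightarrow> (real \<Rightarrow> 'w measure) \<Rightarrow> (real \<Rightarrow> 'w \<Rightarrow> real ^ 'n) \<Rightarrow>
    real \<Rightarrow> real \<Rightarrow>
    (real ^ 'n \<Rightarrow> (real ^ 'n) measure \<Rightarrow> real ^ 'n) \<Rightarrow>
    (real ^ 'n \<Rightarrow> (real ^ 'n) measure \<Rightarrow> real ^ 'n \<Rightarrow> real ^ 'n) \<Rightarrow>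
    (real ^ 'n \<Rightarrow> (real ^ 'n) measure \<Rightarrow> real ^ 'n \<Rightarrow> real ^ 'n) \<Rightarrow>
    ('w \<Rightarrow> real ^ 'n) \<Rightarrow>
    (real \<Rightarrow> 'w \<Rightarrow> real ^ 'n) \<Rightarrow> (real \<Rightarrow> 'w \<Rightarrow> real ^ 'n) \<Rightarrow>
    (real \<Rightarrow> 'w \<Rightarrow> real ^ 'n ^ 'n) \<Rightarrow> bool" where
  "strong_solution M Fil B T \<sigma> W0 F G X0 X W Z \<longleftrightarrow>
     (\<forall>t\<in>{0..T}. X t \<in> borel_measurable (Fil t) \<and> W t \<in> borel_measurable (Fil t) \<and>
                 Z t \<in> borel_measurable (Fil t)) \<and>
     (\<forall>t\<in>{0..T}. X t \<in> L2 M \<and> W t \<in> L2 M) \<and>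
     case_prod X \<in> L2 (time_prod {0..T} M) \<and>
     case_prod W \<in> L2 (time_prod {0..T} M) \<and>
     case_prod Z \<in> L2 (time_prod {0..T} M) \<and>
     integrable (time_prod {0..T} M) (\<lambda>(s, w). lift2 M F (X s) (W s) w) \<and>
     integrable (time_prod {0..T} M) (\<lambda>(s, w). lift2 M G (X s) (W s) w) \<and>
     (\<forall>t\<in>{0..T}. AE w in M.
        X t w = X0 w - (LINT s:{0..t}|lborel. lift2 M F (X s) (W s) w) + \<sigma> *\<^sub>R B t w) \<and>
     (\<forall>t\<in>{0..T}. \<exists>I. has_ito_integral M Fil B t T Z I \<and> (AE w in M.
        W t w = lift1 M W0 (X T) w + (LINT s:{t..T}|lborel. lift2 M G (X s) (W s) w) - I w))"

end

theory Submission
  imports Defs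
begin

text \<open>The process $X'_t = X_t - \sigma B_t = X_0 - \int_0^t f_s\,ds$, with
  $f_s = \tilde F(X_s, W_s)$, has absolutely continuous paths, and this makes the estimate a matter
  of Fubini's theorem.  Write $g_s = \tilde G(X_s, W_s)$, $\omega = \tilde W_0(X_T)$ and
  $V_t = \omega + \int_t^T g_s\,ds$.  The It\^o integral over $[t, T]$ is orthogonal to every square
  integrable $\mathcal F_t$-measurable variable (\<open>L2_ito_orthogonal\<close>), so $W_t$ and $V_t$ have the
  same inner product with all of these; $f_t$ and $W_t$ are among them.  Exchanging the order of
  integration over a triangle then yields the energy identity (\<open>duality\<close>)
  \[ \langle \omega, X'_T\rangle + \int_0^T \langle g_t, X'_t\rangle + \langle W_t, f_t\rangle\,dt
     = \langle V_0, X_0\rangle . \]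

  The monotonicity inequalities are applied to $(X_t, W_t)$ and the reference pair $(\sigma B_t, 0)$:
  the difference of the first components is $X'_t$, and the coefficients at the reference pair are
  bounded in $L^2$ by a constant.  Up to terms of lower order, the integrand is therefore at least
  $\theta(\alpha\|X'_t\|^2 - L\|W_t\|^2)$ for every $\theta \in [0, 1]$, by interpolation between the
  two inequalities for $(F, G)$, and $\langle\omega, X'_T\rangle$ is at least
  $\frac{a_0}{2}\|\omega\|^2$.  The factor $\theta$ may depend on $t$.

  The term $-L\|W_t\|^2$ has the wrong sign, and it is here that the freedom in $\theta$ is used.  From
  $\|W_t\|^2 \le \|V_t\|^2 \le 2\|\omega\|^2 + 2T\int_t^T\|g_s\|^2ds$ and linear growth, the weight
  $\theta(t) = \theta_0 e^{K(t-T)}$ gives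
  \[ \int\theta\|W\|^2 \le 4\|\omega\|^2\int\theta
     + \frac{\mathrm{const}}{K}\Big(\int\theta + \int\theta\|X'\|^2\Big), \]
  because $\int_0^s\theta \le \theta(s)/K$ (\<open>weighted_Gronwall\<close>).  A large $K$ lets
  $\alpha\int\theta\|X'\|^2$ absorb the last term, and a small $\theta_0$ lets
  $\frac{a_0}{2}\|\omega\|^2$ absorb the first, whatever the length of $[0, T]$.  Young's inequality with
  a small parameter disposes of the remaining terms (\<open>a_priori_bound\<close>).  This bounds
  $\|\omega\|^2$ and $\int\|X'\|^2 + \|W\|^2$, and hence, through the integral equations,
  $\|X_t\|$ and $\|W_t\|$ for each $t$; the increments of $X$ inherit the square root from those of
  the Brownian motion.\<close>

section \<open>Square integrable functions and lifted coefficients\<close>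

lemma L2_measurable [measurable_dest]: "X \<in> L2 N \<Longrightarrow> X \<in> borel_measurable N"
  by (simp add: L2_def)

lemma L2_integrable_norm_power2: "X \<in> L2 N \<Longrightarrow> integrable N (\<lambda>w. (norm (X w))\<^sup>2)"
  by (simp add: L2_def)

lemma L2norm_nonneg [simp]: "0 \<le> L2norm N X"
  by (simp add: L2norm_def)

lemma L2norm_power2: "(L2norm N X)\<^sup>2 = (\<integral>w. (norm (X w))\<^sup>2 \<partial>N)"
  by (simp add: L2norm_def)

lemma L2I_bound:
  assumes "X \<in> borel_measurable N" "integrable N h" "AE w in N. (norm (X w))\<^sup>2 \<le> h w"
  shows "X \<in> L2 N"
proof -
  have "AE w in N. norm ((norm (X w))\<^sup>2) \<le> norm (h w)"
    using assms(3) by eventually_elim (auto intro: order_trans)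
  then have "integrable N (\<lambda>w. (norm (X w))\<^sup>2)"
    by (intro Bochner_Integration.integrable_bound[OF assms(2)]) (use assms(1) in auto)
  then show ?thesis using assms(1) by (simp add: L2_def)
qed

lemma norm_add_power2_le: "(norm (x + y))\<^sup>2 \<le> 2 * (norm x)\<^sup>2 + 2 * (norm y)\<^sup>2"
  for x y :: "'b::real_normed_vector"
proof -
  have "(norm (x + y))\<^sup>2 \<le> (norm x + norm y)\<^sup>2"
    by (intro power_mono norm_triangle_ineq) auto
  also have "\<dots> \<le> 2 * (norm x)\<^sup>2 + 2 * (norm y)\<^sup>2"
    using sum_squares_ge_zero[of "norm x - norm y" 0] by (simp add: power2_eq_square algebra_simps)
  finally show ?thesis .
qed

lemma L2_scaleR: "X \<in> L2 N \<Longrightarrow> (\<lambda>w. c *\<^sub>R X w) \<in> L2 N"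
  by (auto simp: L2_def power_mult_distrib)

lemma L2norm_scaleR: "L2norm N (\<lambda>w. c *\<^sub>R X w) = \<bar>c\<bar> * L2norm N X"
  by (simp add: L2norm_def power_mult_distrib real_sqrt_mult)

lemma L2_add:
  assumes "X \<in> L2 N" "Y \<in> L2 N"
  shows "(\<lambda>w. X w + Y w) \<in> L2 N"
    and "(L2norm N (\<lambda>w. X w + Y w))\<^sup>2 \<le> 2 * (L2norm N X)\<^sup>2 + 2 * (L2norm N Y)\<^sup>2"
proof -
  note [measurable] = assms[THEN L2_measurable]
  have i: "integrable N (\<lambda>w. 2 * (norm (X w))\<^sup>2 + 2 * (norm (Y w))\<^sup>2)"
    using assms[THEN L2_integrable_norm_power2] by auto
  show 1: "(\<lambda>w. X w + Y w) \<in> L2 N"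
    by (rule L2I_bound[OF _ i]) (auto intro!: norm_add_power2_le)
  have "(L2norm N (\<lambda>w. X w + Y w))\<^sup>2 \<le> (\<integral>w. 2 * (norm (X w))\<^sup>2 + 2 * (norm (Y w))\<^sup>2 \<partial>N)"
    unfolding L2norm_power2
    by (intro integral_mono L2_integrable_norm_power2[OF 1] i norm_add_power2_le)
  also have "\<dots> = 2 * (L2norm N X)\<^sup>2 + 2 * (L2norm N Y)\<^sup>2"
    unfolding L2norm_power2 using assms[THEN L2_integrable_norm_power2] by simp
  finally show "(L2norm N (\<lambda>w. X w + Y w))\<^sup>2 \<le> 2 * (L2norm N X)\<^sup>2 + 2 * (L2norm N Y)\<^sup>2" .
qed

lemma L2_diff:
  assumes "X \<in> L2 N" "Y \<in> L2 N"
  shows "(\<lambda>w. X w - Y w) \<in> L2 N"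
    and "(L2norm N (\<lambda>w. X w - Y w))\<^sup>2 \<le> 2 * (L2norm N X)\<^sup>2 + 2 * (L2norm N Y)\<^sup>2"
  using L2_add[OF assms(1) L2_scaleR[OF assms(2), of "-1"]]
  by (simp_all add: L2norm_scaleR[of N "-1", simplified])

lemma L2norm_cong_AE:
  assumes "AE w in N. X w = Y w" "X \<in> borel_measurable N" "Y \<in> borel_measurable N"
  shows "L2norm N X = L2norm N Y"
  unfolding L2norm_def
  by (intro arg_cong[where f=sqrt] integral_cong_AE) (use assms in auto)

lemma L2_integrable_inner:
  assumes "X \<in> L2 N" "Y \<in> L2 N"
  shows "integrable N (\<lambda>w. X w \<bullet> Y w)"
proof -
  note [measurable] = assms[THEN L2_measurable]
  have "integrable N (\<lambda>w. (norm (X w))\<^sup>2 + (norm (Y w))\<^sup>2)"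
    using assms[THEN L2_integrable_norm_power2] by auto
  moreover have "\<bar>X w \<bullet> Y w\<bar> \<le> (norm (X w))\<^sup>2 + (norm (Y w))\<^sup>2" for w
  proof -
    have "\<bar>X w \<bullet> Y w\<bar> \<le> norm (X w) * norm (Y w)" by (rule Cauchy_Schwarz_ineq2)
    also have "\<dots> \<le> (norm (X w))\<^sup>2 + (norm (Y w))\<^sup>2"
      using sum_squares_bound[of "norm (X w)" "norm (Y w)"]
        mult_nonneg_nonneg[OF norm_ge_zero norm_ge_zero, of "X w" "Y w"] by linarith
    finally show ?thesis .
  qed
  ultimately show ?thesis
    by (elim Bochner_Integration.integrable_bound) auto
qed

lemma L2inner_Cauchy_Schwarz:
  assumes X: "X \<in> L2 N" and Y: "Y \<in> L2 N"
  shows "\<bar>L2inner N X Y\<bar> \<le> L2norm N X * L2norm N Y"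
proof -
  \<comment> \<open>Integrate $2pq\,|X\cdot Y| \le q^2|X|^2 + p^2|Y|^2$ with $p = \|X\|$ and $q = \|Y\|$;
    the case $pq = 0$ has to be treated apart.\<close>
  let ?p = "L2norm N X" and ?q = "L2norm N Y"
  note [measurable] = X[THEN L2_measurable] Y[THEN L2_measurable]
  note int = L2_integrable_norm_power2[OF X] L2_integrable_norm_power2[OF Y]
  have abs: "\<bar>L2inner N X Y\<bar> \<le> (\<integral>w. \<bar>X w \<bullet> Y w\<bar> \<partial>N)"
    unfolding L2inner_def by (rule integral_abs_bound)
  have deg: "\<bar>L2inner N A D\<bar> = 0" if "L2norm N A = 0" "A \<in> L2 N" for A D :: "'a \<Rightarrow> 'b"
  proof -
    have "AE w in N. (norm (A w))\<^sup>2 = 0"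
      using that integral_nonneg_eq_0_iff_AE[OF L2_integrable_norm_power2[OF that(2)]]
      by (simp add: L2norm_def)
    then have "AE w in N. A w \<bullet> D w = 0" by eventually_elim auto
    then show ?thesis unfolding L2inner_def by (simp add: integral_eq_zero_AE)
  qed
  have sym: "L2inner N X Y = L2inner N Y X"
    by (simp add: L2inner_def inner_commute)
  consider "?p = 0" | "?q = 0" | "?p > 0" "?q > 0"
    using L2norm_nonneg[of N X] L2norm_nonneg[of N Y] by linarith
  then show ?thesis
  proof cases
    case 1 then show ?thesis using deg[OF 1 X] by simp
  next
    case 2 then show ?thesis using deg[OF 2 Y] sym by simp
  next
    case 3
    have "2 * (?p * ?q) * (\<integral>w. \<bar>X w \<bullet> Y w\<bar> \<partial>N) = (\<integral>w. 2 * (?p * ?q) * \<bar>X w \<bullet> Y w\<bar> \<partial>N)"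
      using L2_integrable_inner[OF X Y] by simp
    also have "\<dots> \<le> (\<integral>w. ?q\<^sup>2 * (norm (X w))\<^sup>2 + ?p\<^sup>2 * (norm (Y w))\<^sup>2 \<partial>N)"
    proof (rule integral_mono)
      show "integrable N (\<lambda>w. 2 * (?p * ?q) * \<bar>X w \<bullet> Y w\<bar>)"
        using L2_integrable_inner[OF X Y] by simp
      show "integrable N (\<lambda>w. ?q\<^sup>2 * (norm (X w))\<^sup>2 + ?p\<^sup>2 * (norm (Y w))\<^sup>2)"
        using int by simp
      fix w
      have "2 * (?p * ?q) * \<bar>X w \<bullet> Y w\<bar> \<le> 2 * (?p * ?q) * (norm (X w) * norm (Y w))"
        by (intro mult_left_mono Cauchy_Schwarz_ineq2) simp
      also have "\<dots> \<le> (?q * norm (X w))\<^sup>2 + (?p * norm (Y w))\<^sup>2"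
        using sum_squares_bound[of "?q * norm (X w)" "?p * norm (Y w)"] by (simp add: mult_ac)
      finally show "2 * (?p * ?q) * \<bar>X w \<bullet> Y w\<bar> \<le> ?q\<^sup>2 * (norm (X w))\<^sup>2 + ?p\<^sup>2 * (norm (Y w))\<^sup>2"
        by (simp add: power_mult_distrib)
    qed
    also have "\<dots> = ?q\<^sup>2 * ?p\<^sup>2 + ?p\<^sup>2 * ?q\<^sup>2"
      using int by (simp add: L2norm_power2)
    also have "\<dots> = 2 * (?p * ?q) * (?p * ?q)" by (simp add: power2_eq_square)
    finally have "(\<integral>w. \<bar>X w \<bullet> Y w\<bar> \<partial>N) \<le> ?p * ?q" using 3 by simp
    then show ?thesis using abs by linarith
  qed
qed

lemma mult_le_Young:
  fixes x y \<eta> :: real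
  assumes "\<eta> > 0"
  shows "x * y \<le> \<eta> * x\<^sup>2 + y\<^sup>2 / (4 * \<eta>)"
proof -
  have "0 \<le> (2 * \<eta> * x - y)\<^sup>2" by simp
  then have "x * y * (4 * \<eta>) \<le> 4 * \<eta>\<^sup>2 * x\<^sup>2 + y\<^sup>2"
    unfolding power2_diff by (simp add: power_mult_distrib mult_ac)
  then have "x * y \<le> (4 * \<eta>\<^sup>2 * x\<^sup>2 + y\<^sup>2) / (4 * \<eta>)"
    using assms by (intro mult_imp_le_div_pos) simp_all
  then show ?thesis
    using assms by (simp add: add_divide_distrib power2_eq_square)
qed

lemma L2inner_Young:
  assumes "X \<in> L2 N" "Y \<in> L2 N" "\<eta> > 0"
  shows "\<bar>L2inner N X Y\<bar> \<le> \<eta> * (L2norm N X)\<^sup>2 + (L2norm N Y)\<^sup>2 / (4 * \<eta>)"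
  using L2inner_Cauchy_Schwarz[OF assms(1,2)] mult_le_Young[OF assms(3)] by (rule order_trans)

lemma L2inner_commute: "L2inner N X Y = L2inner N Y X"
  by (simp add: L2inner_def inner_commute)

lemma L2inner_diff_left:
  "X \<in> L2 N \<Longrightarrow> X' \<in> L2 N \<Longrightarrow> Y \<in> L2 N \<Longrightarrow>
    L2inner N (\<lambda>w. X w - X' w) Y = L2inner N X Y - L2inner N X' Y"
  unfolding L2inner_def inner_diff_left
  by (intro Bochner_Integration.integral_diff L2_integrable_inner)

lemma power2_indicator: "(indicator A s :: real)\<^sup>2 = indicator A s"
  by (simp split: split_indicator)

text \<open>Cauchy--Schwarz for $|h|$ and the indicator of \<open>A\<close>; with \<open>A\<close> a time interval it bounds the
  drift accumulated over that interval.\<close>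

lemma norm_integral_indicator_power2_le:
  fixes h :: "'a \<Rightarrow> 'b::euclidean_space"
  assumes h: "h \<in> L2 N" and A: "A \<in> sets N" "emeasure N A < \<infinity>"
  shows "(norm (\<integral>s. indicator A s *\<^sub>R h s \<partial>N))\<^sup>2
    \<le> measure N A * (\<integral>s. indicator A s * (norm (h s))\<^sup>2 \<partial>N)"
    and "integrable N (\<lambda>s. indicator A s *\<^sub>R h s)"
proof -
  note [measurable] = h[THEN L2_measurable] A(1)
  let ?u = "\<lambda>s. indicator A s :: real" and ?v = "\<lambda>s. indicator A s * norm (h s)"
  have u: "?u \<in> L2 N"
    using A by (auto simp: L2_def power2_indicator less_top[symmetric])
  have v: "?v \<in> L2 N"
    by (rule L2I_bound[OF _ L2_integrable_norm_power2[OF h]])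
       (auto simp: power_mult_distrib split: split_indicator)
  have uv: "integrable N ?v"
    using L2_integrable_inner[OF u v] by (simp add: mult.assoc[symmetric] indicator_inter_arith[symmetric])
  show i: "integrable N (\<lambda>s. indicator A s *\<^sub>R h s)"
    by (rule Bochner_Integration.integrable_bound[OF uv]) auto
  have "norm (\<integral>s. indicator A s *\<^sub>R h s \<partial>N) \<le> (\<integral>s. norm (indicator A s *\<^sub>R h s) \<partial>N)"
    by (rule integral_norm_bound)
  also have "\<dots> = L2inner N ?u ?v"
    unfolding L2inner_def by (intro Bochner_Integration.integral_cong) (auto split: split_indicator)
  also have "\<dots> \<le> L2norm N ?u * L2norm N ?v"
    using L2inner_Cauchy_Schwarz[OF u v] by linarith
  finally have "(norm (\<integral>s. indicator A s *\<^sub>R h s \<partial>N))\<^sup>2 \<le> (L2norm N ?u * L2norm N ?v)\<^sup>2"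
    by (intro power_mono) auto
  also have "\<dots> = measure N A * (\<integral>s. indicator A s * (norm (h s))\<^sup>2 \<partial>N)"
    using A by (simp add: power_mult_distrib L2norm_power2 power2_indicator)
  finally show "(norm (\<integral>s. indicator A s *\<^sub>R h s \<partial>N))\<^sup>2
    \<le> measure N A * (\<integral>s. indicator A s * (norm (h s))\<^sup>2 \<partial>N)" .
qed

lemma (in prob_space) law_in_P2:
  assumes X: "X \<in> L2 M"
  shows "law M X \<in> P2" and "sqrt (E2 (law M X)) = L2norm M X"
proof -
  note [measurable] = X[THEN L2_measurable]
  show "law M X \<in> P2"
    using L2_integrable_norm_power2[OF X]
    by (auto simp: P2_def law_def integrable_distr_eq intro!: prob_space_distr)
  show "sqrt (E2 (law M X)) = L2norm M X"
    by (simp add: E2_def law_def L2norm_def integral_distr)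
qed

text \<open>The diagonal coupling has cost zero.  This is what lets the measure argument of a
  \<open>W2\<close>-continuous coefficient be frozen.\<close>

lemma W2_self:
  assumes "\<mu> \<in> P2"
  shows "W2 \<mu> \<mu> = 0"
proof -
  from assms have p: "prob_space \<mu>" and s[measurable_cong]: "sets \<mu> = sets borel"
    by (auto simp: P2_def)
  let ?d = "distr \<mu> borel (\<lambda>x. (x, x))"
  have m [measurable]: "(\<lambda>x. (x, x)) \<in> measurable \<mu> borel"
    by (intro borel_measurable_Pair) (use s in measurable)
  have fs [measurable]: "fst \<in> borel \<rightarrow>\<^sub>M borel" "snd \<in> borel \<rightarrow>\<^sub>M borel"
   
    by (auto intro!: borel_measurable_continuous_onI continuous_intros)
  have "?d \<in> couplings \<mu> \<mu>"
    using p s by (auto simp: couplings_def distr_distr[OF _ m] fs o_def distr_id2 intro!: prob_space.prob_space_distr)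
  moreover have "(\<integral>p. (norm (fst p - snd p))\<^sup>2 \<partial>?d) = 0"
    by (subst integral_distr) auto
  ultimately have "(INF \<pi>\<in>couplings \<mu> \<mu>. \<integral>p. (norm (fst p - snd p))\<^sup>2 \<partial>\<pi>) \<le> 0"
    by (metis (no_types, lifting) bdd_belowI2 cINF_lower integral_nonneg_AE always_eventually zero_le_power2)
  moreover have "0 \<le> (INF \<pi>\<in>couplings \<mu> \<mu>. \<integral>p. (norm (fst p - snd p))\<^sup>2 \<partial>\<pi>)"
    using \<open>?d \<in> _\<close> by (intro cINF_greatest) auto
  ultimately show ?thesis by (simp add: W2_def)
qed

lemma W2_continuous_imp_continuous_on:
  assumes "W2_continuous f" "\<mu> \<in> P2"
  shows "continuous_on UNIV (\<lambda>x. f x \<mu>)"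
  unfolding continuous_on_iff
proof (intro ballI allI impI)
  fix x and e :: real assume "e > 0"
  with assms obtain d where "d > 0"
    "\<And>y \<nu>. \<nu> \<in> P2 \<Longrightarrow> dist y x < d \<Longrightarrow> W2 \<nu> \<mu> < d \<Longrightarrow> dist (f y \<nu>) (f x \<mu>) < e"
    unfolding W2_continuous_def by meson
  with W2_self[OF assms(2)] assms(2)
  show "\<exists>d>0. \<forall>y\<in>UNIV. dist y x < d \<longrightarrow> dist (f y \<mu>) (f x \<mu>) < e"
    by (intro exI[of _ d]) auto
qed

lemma borel_measurable_lift2:
  assumes "W2_continuous (\<lambda>(x, u) \<mu>. H x \<mu> u)" "law M X \<in> P2"
    and [measurable]: "X \<in> borel_measurable N" "U \<in> borel_measurable N"
  shows "lift2 M H X U \<in> borel_measurable N"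
proof -
  have c: "continuous_on UNIV (\<lambda>p. case p of (x, u) \<Rightarrow> H x (law M X) u)"
    using W2_continuous_imp_continuous_on[OF assms(1,2)] by (simp add: case_prod_beta)
  have [measurable]: "(\<lambda>p. case p of (x, u) \<Rightarrow> H x (law M X) u) \<in> borel_measurable borel"
    using c by (rule borel_measurable_continuous_onI)
  have "(\<lambda>w. (case (X w, U w) of (x, u) \<Rightarrow> H x (law M X) u)) \<in> borel_measurable N"
    by measurable
  then show ?thesis by (simp add: lift2_def)
qed

text \<open>Since $\sqrt{E_2(\mathcal L(X))} = \|X\|$, linear growth of a coefficient becomes linear growth
  of its lift in $L^2$.\<close>

lemma (in prob_space) L2_lift2:
  assumes c: "W2_continuous (\<lambda>(x, u) \<mu>. H x \<mu> u)"
    and growth: "\<And>x \<mu> u. \<mu> \<in> P2 \<Longrightarrow> norm (H x \<mu> u) \<le> k * (1 + norm x + norm u + sqrt (E2 \<mu>))"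
    and X: "X \<in> L2 M" and U: "U \<in> L2 M"
  shows "lift2 M H X U \<in> L2 M"
    and "(L2norm M (lift2 M H X U))\<^sup>2 \<le> 8 * k\<^sup>2 * (1 + (L2norm M X)\<^sup>2 + (L2norm M U)\<^sup>2)"
proof -
  let ?h = "\<lambda>w. 4 * k\<^sup>2 * (1 + (L2norm M X)\<^sup>2 + (norm (X w))\<^sup>2 + (norm (U w))\<^sup>2)"
  have m: "lift2 M H X U \<in> borel_measurable M"
    by (rule borel_measurable_lift2[OF c law_in_P2(1)[OF X] X[THEN L2_measurable] U[THEN L2_measurable]])
  have i: "integrable M ?h"
    using X[THEN L2_integrable_norm_power2] U[THEN L2_integrable_norm_power2]
    by (intro integrable_mult_right Bochner_Integration.integrable_add) auto
  have b: "(norm (lift2 M H X U w))\<^sup>2 \<le> ?h w" for w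
  proof -
    let ?a = "norm (X w)" and ?b = "norm (U w)" and ?c = "L2norm M X"
    have "norm (lift2 M H X U w) \<le> k * (1 + ?a + ?b + ?c)"
      using growth[OF law_in_P2(1)[OF X]] law_in_P2(2)[OF X] by (simp add: lift2_def)
    then have "(norm (lift2 M H X U w))\<^sup>2 \<le> k\<^sup>2 * (1 + ?a + ?b + ?c)\<^sup>2"
      by (metis norm_ge_zero power_mono power_mult_distrib)
    also have "k\<^sup>2 * (1 + ?a + ?b + ?c)\<^sup>2 \<le> k\<^sup>2 * (4 * (1 + ?c\<^sup>2 + ?a\<^sup>2 + ?b\<^sup>2))"
    proof (rule mult_left_mono)
      show "(1 + ?a + ?b + ?c)\<^sup>2 \<le> 4 * (1 + ?c\<^sup>2 + ?a\<^sup>2 + ?b\<^sup>2)"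
      proof -
        have "0 \<le> (1 - ?a)\<^sup>2 + (1 - ?b)\<^sup>2 + (1 - ?c)\<^sup>2 + (?a - ?b)\<^sup>2 + (?a - ?c)\<^sup>2 + (?b - ?c)\<^sup>2"
          by simp
        then show ?thesis by (simp add: power2_eq_square algebra_simps)
      qed
    qed simp
    finally show ?thesis by (simp only: mult_ac)
  qed
  show L: "lift2 M H X U \<in> L2 M"
    by (rule L2I_bound[OF m i]) (use b in auto)
  have "(L2norm M (lift2 M H X U))\<^sup>2 \<le> (\<integral>w. ?h w \<partial>M)"
    unfolding L2norm_power2[of _ "lift2 M H X U"]
    by (intro integral_mono L2_integrable_norm_power2[OF L] i b)
  also have "\<dots> = 4 * k\<^sup>2 * (1 + 2 * (L2norm M X)\<^sup>2 + (L2norm M U)\<^sup>2)"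
    using X[THEN L2_integrable_norm_power2] U[THEN L2_integrable_norm_power2]
    by (simp add: L2norm_power2 prob_space)
  also have "\<dots> = 8 * k\<^sup>2 * (1 + (L2norm M X)\<^sup>2 + (L2norm M U)\<^sup>2) - 4 * k\<^sup>2 * (1 + (L2norm M U)\<^sup>2)"
    by (simp add: algebra_simps)
  also have "\<dots> \<le> 8 * k\<^sup>2 * (1 + (L2norm M X)\<^sup>2 + (L2norm M U)\<^sup>2)" by simp
  finally show "(L2norm M (lift2 M H X U))\<^sup>2 \<le> 8 * k\<^sup>2 * (1 + (L2norm M X)\<^sup>2 + (L2norm M U)\<^sup>2)" .
qed

section \<open>Brownian increments and the stochastic integral\<close>

lemma nn_integral_normal_density:
  assumes "0 < \<sigma>"
  shows "(\<integral>\<^sup>+x. ennreal (normal_density \<mu> \<sigma> x) \<partial>lborel) = 1"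
  using assms by (subst nn_integral_eq_integral) auto

text \<open>The joint density is a product over the coordinates; integrating out all coordinates but one
  leaves the one-dimensional normal density.\<close>

lemma distributed_normal_component:
  fixes Y :: "'w \<Rightarrow> real ^ 'n"
  assumes \<sigma>: "0 < \<sigma>"
    and Y: "distributed M lborel Y (\<lambda>x. ennreal (\<Prod>i\<in>UNIV. normal_density 0 \<sigma> (x $ i)))"
  shows "distributed M lborel (\<lambda>w. Y w $ j) (\<lambda>x. ennreal (normal_density 0 \<sigma> x))"
proof -
  let ?\<phi> = "normal_density 0 \<sigma>"
  have m [measurable]: "Y \<in> measurable M borel"
    using distributed_measurable[OF Y] by simp
  have j [measurable]: "(\<lambda>x :: real ^ 'n. x $ j) \<in> borel_measurable borel"
    by (intro borel_measurable_continuous_onI continuous_intros)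
  have "distr M lborel (\<lambda>w. Y w $ j) = density lborel (\<lambda>x. ennreal (?\<phi> x))"
  proof (rule measure_eqI)
    fix A assume "A \<in> sets (distr M lborel (\<lambda>w. Y w $ j))"
    then have A [measurable]: "A \<in> sets borel" by simp
    define h where "h b t = ennreal (?\<phi> t) * (if b = axis j 1 then indicator A t else 1)"
      for b :: "real ^ 'n" and t :: real
    have [measurable]: "h b \<in> borel_measurable borel" for b
      unfolding h_def by (cases "b = axis j 1") auto
    have bas: "(Basis :: (real ^ 'n) set) = range (\<lambda>i. axis i 1)" "inj (\<lambda>i :: 'n. axis i (1::real))"
      by (auto simp: Basis_vec_def inj_def axis_eq_axis)
    have re: "(\<Prod>b\<in>Basis. k b) = (\<Prod>i\<in>UNIV. k (axis i 1))" for k :: "real ^ 'n \<Rightarrow> ennreal"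
      unfolding bas(1) by (subst prod.reindex[OF bas(2)]) simp
    have "emeasure (distr M lborel (\<lambda>w. Y w $ j)) A = emeasure (distr M lborel Y) ((\<lambda>x. x $ j) -` A)"
      using measurable_sets[OF j A]
      by (simp add: emeasure_distr vimage_def)
    also have "\<dots> = (\<integral>\<^sup>+x. ennreal (\<Prod>i\<in>UNIV. ?\<phi> (x $ i)) * indicator A (x $ j) \<partial>lborel)"
      using measurable_sets[OF j A]
      unfolding distributed_distr_eq_density[OF Y]
      by (subst emeasure_density)
        (auto intro!: nn_integral_cong simp: indicator_def)
    also have "\<dots> = (\<integral>\<^sup>+x. (\<Prod>b\<in>Basis. h b (x \<bullet> b)) \<partial>lborel)"
    proof (rule nn_integral_cong)
      fix x :: "real ^ 'n"
      have "(\<Prod>b\<in>Basis. h b (x \<bullet> b))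
          = (\<Prod>i\<in>UNIV. ennreal (?\<phi> (x $ i))) * (\<Prod>i\<in>UNIV. if i = j then indicator A (x $ i) else 1)"
        unfolding re h_def prod.distrib
        by (simp add: inner_axis axis_eq_axis)
      also have "\<dots> = ennreal (\<Prod>i\<in>UNIV. ?\<phi> (x $ i)) * indicator A (x $ j)"
        by (simp add: prod_ennreal prod.delta)
      finally show "ennreal (\<Prod>i\<in>UNIV. ?\<phi> (x $ i)) * indicator A (x $ j) = (\<Prod>b\<in>Basis. h b (x \<bullet> b))" ..
    qed
    also have "\<dots> = (\<Prod>b\<in>Basis. (\<integral>\<^sup>+t. h b t \<partial>lborel))"
      by (rule nn_integral_lborel_prod) auto
    also have "\<dots> = (\<Prod>i\<in>UNIV. if i = j then (\<integral>\<^sup>+t. ennreal (?\<phi> t) * indicator A t \<partial>lborel) else 1)"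
      unfolding re h_def
      by (intro prod.cong) (auto simp: axis_eq_axis nn_integral_normal_density[OF \<sigma>])
    also have "\<dots> = emeasure (density lborel (\<lambda>x. ennreal (?\<phi> x))) A"
      by (simp add: prod.delta emeasure_density)
    finally show "emeasure (distr M lborel (\<lambda>w. Y w $ j)) A
        = emeasure (density lborel (\<lambda>x. ennreal (?\<phi> x))) A" .
  qed simp
  then show ?thesis by (simp add: distributed_def)
qed

lemma norm_vec_power2: "(norm x)\<^sup>2 = (\<Sum>i\<in>UNIV. (x $ i)\<^sup>2)" for x :: "real ^ 'n"
  by (simp add: norm_vec_def L2_set_def sum_nonneg)

lemma (in prob_space) normal_moments:
  assumes \<sigma>: "0 < \<sigma>" and D: "distributed M lborel Y (\<lambda>x. ennreal (normal_density 0 \<sigma> x))"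
  shows "integrable M Y" "expectation Y = 0" "integrable M (\<lambda>w. (Y w)\<^sup>2)"
    "expectation (\<lambda>w. (Y w)\<^sup>2) = \<sigma>\<^sup>2"
proof -
  have e: "expectation Y = 0" "variance Y = \<sigma>\<^sup>2"
    using normal_distributed_expectation[OF \<sigma> D] normal_distributed_variance[OF \<sigma> D] by auto
  then show "expectation Y = 0" "expectation (\<lambda>w. (Y w)\<^sup>2) = \<sigma>\<^sup>2" by simp_all
  show "integrable M Y"
    using distributed_integrable[OF D, of "\<lambda>x. x"] integrable_normal_moment_nz_1[OF \<sigma>, of 0] by simp
  show "integrable M (\<lambda>w. (Y w)\<^sup>2)"
    using distributed_integrable[OF D, of "\<lambda>x. x\<^sup>2"] integrable_normal_moment[OF \<sigma>, of 0 2] by simp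
qed

context brownian_motion
begin

lemma Fil_measurable_imp_measurable:
  "Y \<in> measurable (Fil t) N \<Longrightarrow> Y \<in> measurable M N"
  by (rule measurable_mono[THEN subsetD, of N N]) (use Fil_sub space_F in auto)

lemma Fil_measurable_mono:
  "s \<le> t \<Longrightarrow> Y \<in> measurable (Fil s) N \<Longrightarrow> Y \<in> measurable (Fil t) N"
  by (rule measurable_mono[THEN subsetD, of N N]) (use sets_F_mono space_F in auto)

lemma increment_moments:
  fixes s t :: real
  assumes "0 \<le> s" "s < t" "t \<le> T"
  shows "integrable M (\<lambda>w. (B t w - B s w) $ j)"
    and "(\<integral>w. (B t w - B s w) $ j \<partial>M) = 0"
    and "(\<lambda>w. B t w - B s w) \<in> L2 M"
    and "(L2norm M (\<lambda>w. B t w - B s w))\<^sup>2 = real CARD('n) * (t - s)"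
proof -
  have \<sigma>: "0 < sqrt (t - s)" using assms by simp
  note mom = normal_moments[OF \<sigma> distributed_normal_component[OF \<sigma> B_increment_normal[OF assms]]]
  show "integrable M (\<lambda>w. (B t w - B s w) $ j)" "(\<integral>w. (B t w - B s w) $ j \<partial>M) = 0"
    by (rule mom)+
  have m: "(\<lambda>w. B t w - B s w) \<in> borel_measurable M"
    using distributed_measurable[OF B_increment_normal[OF assms]] by simp
  then show "(\<lambda>w. B t w - B s w) \<in> L2 M"
    unfolding L2_def norm_vec_power2 using mom(3) by auto
  show "(L2norm M (\<lambda>w. B t w - B s w))\<^sup>2 = real CARD('n) * (t - s)"
    unfolding L2norm_power2 norm_vec_power2
    unfolding Bochner_Integration.integral_sum[OF mom(3)] mom(4)
    using assms by simp
qed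

lemma B_L2:
  fixes t :: real
  assumes "t \<in> {0..T}"
  shows "B t \<in> L2 M" and "(L2norm M (B t))\<^sup>2 = real CARD('n) * t"
proof -
  have m: "B r \<in> borel_measurable M" if "r \<in> {0..T}" for r
    using B_adapted[OF that] by (rule Fil_measurable_imp_measurable)
  have "B t \<in> L2 M \<and> (L2norm M (B t))\<^sup>2 = real CARD('n) * t"
  proof (cases "t = 0")
    case True
    have "L2norm M (B 0) = L2norm M (\<lambda>_. 0 :: real ^ 'n)"
      using m[of 0] assms by (intro L2norm_cong_AE B_zero) auto
    moreover have "AE w in M. (norm (B 0 w))\<^sup>2 \<le> 0"
      using B_zero by eventually_elim simp
    then have "B 0 \<in> L2 M"
      using m[of 0] assms by (intro L2I_bound[where h="\<lambda>_. 0"]) auto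
    ultimately show ?thesis using True by (simp add: L2norm_def)
  next
    case False
    then have t: "0 < t" "t \<le> T" using assms by auto
    have ae: "AE w in M. B t w - B 0 w = B t w"
      using B_zero by eventually_elim simp
    have ae': "AE w in M. (norm (B t w))\<^sup>2 \<le> (norm (B t w - B 0 w))\<^sup>2"
      using B_zero by eventually_elim simp
    have "B t \<in> L2 M"
      by (rule L2I_bound[OF m[OF assms] L2_integrable_norm_power2[OF increment_moments(3)[OF order_refl t]] ae'])
    moreover have "L2norm M (\<lambda>w. B t w - B 0 w) = L2norm M (B t)"
      using m[of t] m[of 0] assms t by (intro L2norm_cong_AE[OF ae]) auto
    ultimately show ?thesis using increment_moments(4)[OF order_refl t] by simp
  qed
  then show "B t \<in> L2 M" "(L2norm M (B t))\<^sup>2 = real CARD('n) * t" by auto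
qed

text \<open>An increment after time \<open>s\<close> is centred and independent of everything known at time \<open>s\<close>.\<close>

lemma integral_mult_increment:
  fixes Y :: "'w \<Rightarrow> real"
  assumes st: "0 \<le> s" "s < t" "t \<le> T" and Y: "Y \<in> borel_measurable (Fil s)" "integrable M Y"
  shows "integrable M (\<lambda>w. Y w * (B t w - B s w) $ j)"
    and "(\<integral>w. Y w * (B t w - B s w) $ j \<partial>M) = 0"
proof -
  let ?D = "\<lambda>w. (B t w - B s w) $ j"
  note mom = increment_moments[OF st]
  have j [measurable]: "(\<lambda>x :: real ^ 'n. x $ j) \<in> borel_measurable borel"
    by (intro borel_measurable_continuous_onI continuous_intros)
  have "indep_var borel Y borel ?D"
    unfolding indep_var_eq
  proof (intro conjI)
    show "Y \<in> borel_measurable M" "?D \<in> borel_measurable M"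
      using Y(2) mom(1) by (auto dest: borel_measurable_integrable)
    have 1: "sigma_sets (space M) {Y -` A \<inter> space M |A. A \<in> sets borel} \<subseteq> sets (Fil s)"
      using measurable_sets[OF Y(1)] space_F
      by (intro sets.sigma_sets_subset[of _ "Fil s", unfolded space_F]) auto
    have 2: "sigma_sets (space M) {?D -` A \<inter> space M |A. A \<in> sets borel}
        \<subseteq> {(\<lambda>w. B t w - B s w) -` A \<inter> space M |A. A \<in> sets borel}"
    proof -
      let ?V = "vimage_algebra (space M) (\<lambda>w. B t w - B s w) borel"
      have V: "sets ?V = {(\<lambda>w. B t w - B s w) -` A \<inter> space M |A. A \<in> sets borel}"
        by (auto simp: sets_vimage_algebra2)
      have "?D \<in> borel_measurable ?V"
        by (rule measurable_compose[OF measurable_vimage_algebra1 j]) auto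
      then have "{?D -` A \<inter> space M |A. A \<in> sets borel} \<subseteq> sets ?V"
        using measurable_sets[of ?D ?V borel] by auto
      then show ?thesis
        using sets.sigma_sets_subset[of _ ?V] V by simp
    qed
    show "indep_set (sigma_sets (space M) {Y -` A \<inter> space M |A. A \<in> sets borel})
        (sigma_sets (space M) {?D -` A \<inter> space M |A. A \<in> sets borel})"
      using B_increment_indep[OF st] unfolding indep_set_def
      by (rule indep_sets_mono_sets) (use 1 2 in \<open>auto split: bool.split\<close>)
  qed
  from indep_var_integrable[OF this Y(2) mom(1)] indep_var_lebesgue_integral[OF this Y(2) mom(1)]
  show "integrable M (\<lambda>w. Y w * ?D w)" "(\<integral>w. Y w * ?D w \<partial>M) = 0"
    using mom(2) by auto
qed

text \<open>The integral of an elementary integrand is a sum of increments, each multiplied by something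
  known at its left end point; multiplication by \<open>Y\<close>, which is known already at time \<open>t\<close>, preserves
  this form, so the expectation vanishes.  Orthogonality passes to $L^2$-limits.\<close>

lemma L2_ito_orthogonal:
  assumes t: "0 \<le> t" and ito: "has_ito_integral M Fil B t T Z I"
    and Y: "Y \<in> borel_measurable (Fil t)" "Y \<in> L2 M"
  shows "L2inner M I Y = 0"
proof -
  from ito obtain m \<tau> \<xi> where I: "I \<in> L2 M"
    and el: "\<And>k. elementary M Fil t T (m k) (\<tau> k) (\<xi> k)"
    and lim: "(\<lambda>k. L2norm M (\<lambda>w. I w - elementary_integral B (m k) (\<tau> k) (\<xi> k) w)) \<longlonglongrightarrow> 0"
    unfolding has_ito_integral_def by blast
  have el0: "elementary_integral B m \<tau> \<xi> \<in> L2 M \<and> L2inner M (elementary_integral B m \<tau> \<xi>) Y = 0"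
    if el: "elementary M Fil t T m \<tau> \<xi>" for m \<tau> \<xi>
  proof -
    have mono: "\<tau> i \<le> \<tau> k" if "i \<le> k" "k \<le> m" for i k
      using that el by (induction k rule: dec_induct) (auto simp: elementary_def intro: order_trans)
    have end_pts: "\<tau> 0 = t" "\<tau> m = T" using el by (auto simp: elementary_def)
    have step: "(\<lambda>w. \<xi> i w *v (B (\<tau> (Suc i)) w - B (\<tau> i) w)) \<in> L2 M \<and>
        L2inner M (\<lambda>w. \<xi> i w *v (B (\<tau> (Suc i)) w - B (\<tau> i) w)) Y = 0" if i: "i < m" for i
    proof (cases "\<tau> i = \<tau> (Suc i)")
      case True then show ?thesis by (simp add: L2inner_def L2_def)
    next
      case False
      have r: "t \<le> \<tau> i" "0 \<le> \<tau> i" "\<tau> i < \<tau> (Suc i)" "\<tau> (Suc i) \<le> T"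
        using mono[of 0 i] mono[of "Suc i" m] mono[of i "Suc i"] i False end_pts t by auto
      let ?D = "\<lambda>w. B (\<tau> (Suc i)) w - B (\<tau> i) w"
      have \<xi>: "\<xi> i \<in> borel_measurable (Fil (\<tau> i))" and bd: "bounded (\<xi> i ` space M)"
        using el i by (auto simp: elementary_def)
      have Yi: "Y \<in> borel_measurable (Fil (\<tau> i))" by (rule Fil_measurable_mono[OF r(1) Y(1)])
      have cm [measurable]: "(\<lambda>x :: real ^ 'n. x $ a) \<in> borel_measurable borel"
        "(\<lambda>x :: real ^ 'n ^ 'n. x $ a $ b) \<in> borel_measurable borel"
        "(\<lambda>x :: real ^ 'n ^ 'n. norm x) \<in> borel_measurable borel" for a b
        by (intro borel_measurable_continuous_onI continuous_intros)+
      have \<xi>M [measurable]: "(\<lambda>w. \<xi> i w $ a $ b) \<in> borel_measurable M" for a b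
        by (rule measurable_compose[OF Fil_measurable_imp_measurable[OF \<xi>] cm(2)])
      have DL: "?D \<in> L2 M" using increment_moments(3)[OF r(2-4)] .
      have [measurable]: "(\<lambda>w. Y w $ a) \<in> borel_measurable M" "(\<lambda>w. ?D w $ a) \<in> borel_measurable M" for a
        using measurable_compose[OF L2_measurable[OF Y(2)] cm(1)]
          measurable_compose[OF L2_measurable[OF DL] cm(1)] by auto
      have comp: "(\<lambda>w. \<xi> i w *v ?D w) = (\<lambda>w. \<chi> a. \<Sum>b\<in>UNIV. \<xi> i w $ a $ b * ?D w $ b)"
        by (simp add: matrix_vector_mult_def)
      obtain c where c: "\<And>w. w \<in> space M \<Longrightarrow> norm (\<xi> i w) \<le> c"
        using bd by (auto simp: bounded_iff)
      have cb: "\<bar>\<xi> i w $ a $ b\<bar> \<le> c" if "w \<in> space M" for w a b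
        using c[OF that] component_le_norm_cart[of "\<xi> i w $ a" b] Finite_Cartesian_Product.norm_nth_le[of "\<xi> i w" a]
        by linarith
      obtain K where K: "\<And>w. w \<in> space M \<Longrightarrow> norm (\<xi> i w *v ?D w) \<le> K * norm (?D w)"
      proof
        fix w assume w: "w \<in> space M"
        have "norm (\<xi> i w *v ?D w) \<le> (\<Sum>a\<in>UNIV. \<bar>(\<xi> i w *v ?D w) $ a\<bar>)"
          by (rule norm_le_l1_cart)
        also have "\<dots> \<le> (\<Sum>a\<in>(UNIV::'n set). \<Sum>b\<in>(UNIV::'n set). c * norm (?D w))"
        proof (rule sum_mono)
          fix a
          have "\<bar>(\<xi> i w *v ?D w) $ a\<bar> \<le> (\<Sum>b\<in>UNIV. \<bar>\<xi> i w $ a $ b * ?D w $ b\<bar>)"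
            by (simp add: matrix_vector_mult_def)
          also have "\<dots> \<le> (\<Sum>b\<in>(UNIV::'n set). c * norm (?D w))"
            unfolding abs_mult
            by (intro sum_mono mult_mono cb w component_le_norm_cart) (use cb[OF w] in \<open>auto intro: order_trans[OF abs_ge_zero]\<close>)
          finally show "\<bar>(\<xi> i w *v ?D w) $ a\<bar> \<le> (\<Sum>b\<in>(UNIV::'n set). c * norm (?D w))" .
        qed
        also have "\<dots> = (CARD('n) * CARD('n) * c) * norm (?D w)" by simp
        finally show "norm (\<xi> i w *v ?D w) \<le> (CARD('n) * CARD('n) * c) * norm (?D w)" .
      qed
      have L: "(\<lambda>w. \<xi> i w *v ?D w) \<in> L2 M"
      proof (rule L2I_bound)
        show "(\<lambda>w. \<xi> i w *v ?D w) \<in> borel_measurable M"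
          unfolding comp
          by (subst borel_measurable_euclidean_space) (auto simp: Basis_vec_def inner_axis simp del: vector_minus_component)
        show "integrable M (\<lambda>w. K\<^sup>2 * (norm (?D w))\<^sup>2)"
          using L2_integrable_norm_power2[OF DL] by simp
        show "AE w in M. (norm (\<xi> i w *v ?D w))\<^sup>2 \<le> K\<^sup>2 * (norm (?D w))\<^sup>2"
          using K by (intro AE_I2) (metis norm_ge_zero power_mono power_mult_distrib)
      qed
      have YI: "integrable M (\<lambda>w. Y w $ a * \<xi> i w $ a $ b)" for a b
      proof (rule Bochner_Integration.integrable_bound)
        have "integrable M (\<lambda>w. norm (Y w))"
          by (rule square_integrable_imp_integrable[OF _ L2_integrable_norm_power2[OF Y(2)]])
            (use L2_measurable[OF Y(2)] in auto)
        then show "integrable M (\<lambda>w. norm (Y w) * c)" by simp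
        show "AE w in M. norm (Y w $ a * \<xi> i w $ a $ b) \<le> norm (norm (Y w) * c)"
        proof (rule AE_I2)
          fix w assume w: "w \<in> space M"
          have "norm (Y w $ a * \<xi> i w $ a $ b) \<le> norm (Y w) * c"
            unfolding real_norm_def abs_mult
            by (intro mult_mono component_le_norm_cart cb w) auto
          then show "norm (Y w $ a * \<xi> i w $ a $ b) \<le> norm (norm (Y w) * c)"
            by (smt (verit) real_norm_def)
        qed
      qed simp
      have YF: "(\<lambda>w. Y w $ a * \<xi> i w $ a $ b) \<in> borel_measurable (Fil (\<tau> i))" for a b
        using measurable_compose[OF Yi cm(1)] measurable_compose[OF \<xi> cm(2)] by auto
      have "L2inner M (\<lambda>w. \<xi> i w *v ?D w) Y
          = (\<integral>w. (\<Sum>a\<in>UNIV. \<Sum>b\<in>UNIV. (Y w $ a * \<xi> i w $ a $ b) * ?D w $ b) \<partial>M)"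
        unfolding L2inner_def inner_vec_def comp
        by (intro Bochner_Integration.integral_cong)
           (auto simp: sum_distrib_left sum_distrib_right mult_ac)
      also have "\<dots> = (\<Sum>a\<in>UNIV. \<Sum>b\<in>UNIV. \<integral>w. (Y w $ a * \<xi> i w $ a $ b) * ?D w $ b \<partial>M)"
        using integral_mult_increment(1)[OF r(2-4) YF YI]
        by (simp add: Bochner_Integration.integral_sum)
      also have "\<dots> = 0"
        using integral_mult_increment(2)[OF r(2-4) YF YI] by simp
      finally show ?thesis using L by simp
    qed
    have "(\<lambda>w. \<Sum>i<k. \<xi> i w *v (B (\<tau> (Suc i)) w - B (\<tau> i) w)) \<in> L2 M \<and>
        L2inner M (\<lambda>w. \<Sum>i<k. \<xi> i w *v (B (\<tau> (Suc i)) w - B (\<tau> i) w)) Y = 0" if "k \<le> m" for k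
      using that
    proof (induction k)
      case 0 then show ?case by (simp add: L2inner_def L2_def)
    next
      case (Suc k)
      then have IH: "(\<lambda>w. \<Sum>i<k. \<xi> i w *v (B (\<tau> (Suc i)) w - B (\<tau> i) w)) \<in> L2 M"
        "L2inner M (\<lambda>w. \<Sum>i<k. \<xi> i w *v (B (\<tau> (Suc i)) w - B (\<tau> i) w)) Y = 0" by auto
      have st: "(\<lambda>w. \<xi> k w *v (B (\<tau> (Suc k)) w - B (\<tau> k) w)) \<in> L2 M"
        "L2inner M (\<lambda>w. \<xi> k w *v (B (\<tau> (Suc k)) w - B (\<tau> k) w)) Y = 0"
        using step[of k] Suc.prems by auto
      show ?case
        using L2_add(1)[OF IH(1) st(1)] IH(2) st(2)
          L2_integrable_inner[OF IH(1) Y(2)] L2_integrable_inner[OF st(1) Y(2)]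
        by (simp add: L2inner_def inner_add_left)
    qed
    from this[of m] show ?thesis by (simp add: elementary_integral_def[abs_def])
  qed
  have "\<bar>L2inner M I Y\<bar> \<le> L2norm M (\<lambda>w. I w - elementary_integral B (m k) (\<tau> k) (\<xi> k) w) * L2norm M Y" for k
    using L2inner_Cauchy_Schwarz[OF L2_diff(1)[OF I el0[OF el[of k], THEN conjunct1]] Y(2)]
      L2inner_diff_left[OF I el0[OF el[of k], THEN conjunct1] Y(2)] el0[OF el[of k]] by simp
  then have "\<bar>L2inner M I Y\<bar> \<le> 0 * L2norm M Y"
    by (intro tendsto_lowerbound[OF tendsto_mult_right[OF lim]]) auto
  then show ?thesis by simp
qed

end

section \<open>Integration over the time horizon\<close>

abbreviation horizon :: "real \<Rightarrow> real measure" where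
  "horizon T \<equiv> restrict_space lborel {0..T}"

lemma finite_measure_horizon: "finite_measure (horizon T)"
  by (intro finite_measureI) (simp add: space_restrict_space emeasure_restrict_space emeasure_lborel_Icc_eq)

lemma sigma_finite_horizon [simp, intro]: "sigma_finite_measure (horizon T)"
  using finite_measure_horizon by (rule finite_measure.sigma_finite_measure)

lemma measurable_ident_horizon [measurable]: "(\<lambda>x. x) \<in> horizon T \<rightarrow>\<^sub>M borel"
  by (intro measurable_restrict_space1) simp

lemma measure_horizon:
  "0 \<le> a \<Longrightarrow> a \<le> b \<Longrightarrow> b \<le> T \<Longrightarrow> measure (horizon T) {a..b} = b - a"
  "0 \<le> a \<Longrightarrow> b \<le> T \<Longrightarrow> {a..b} \<in> sets (horizon T)"
  "emeasure (horizon T) A < \<infinity>"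
  "0 \<le> a \<Longrightarrow> a \<le> b \<Longrightarrow> b \<le> T \<Longrightarrow> measure (horizon T) {a<..b} = b - a"
  "0 \<le> a \<Longrightarrow> b \<le> T \<Longrightarrow> {a<..b} \<in> sets (horizon T)"
proof -
  show "0 \<le> a \<Longrightarrow> a \<le> b \<Longrightarrow> b \<le> T \<Longrightarrow> measure (horizon T) {a<..b} = b - a"
    by (subst measure_restrict_space) auto
  show "0 \<le> a \<Longrightarrow> b \<le> T \<Longrightarrow> {a<..b} \<in> sets (horizon T)"
    by (subst sets_restrict_space_iff) auto
  show "0 \<le> a \<Longrightarrow> a \<le> b \<Longrightarrow> b \<le> T \<Longrightarrow> measure (horizon T) {a..b} = b - a"
    by (subst measure_restrict_space) auto
  show "0 \<le> a \<Longrightarrow> b \<le> T \<Longrightarrow> {a..b} \<in> sets (horizon T)"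
    by (subst sets_restrict_space_iff) auto
  show "emeasure (horizon T) A < \<infinity>"
    using finite_measure.emeasure_finite[OF finite_measure_horizon, of T A] by (simp add: less_top)
qed

lemma set_integral_horizon:
  fixes h :: "real \<Rightarrow> 'b::euclidean_space"
  assumes "0 \<le> a" "b \<le> T"
  shows "(LINT s:{a..b}|lborel. h s) = (\<integral>s. indicator {a..b} s *\<^sub>R h s \<partial>horizon T)"
  unfolding set_lebesgue_integral_def
  using assms by (subst integral_restrict_space)
    (auto intro!: Bochner_Integration.integral_cong split: split_indicator)

lemma integral_const_horizon: "0 \<le> T \<Longrightarrow> (\<integral>s. c \<partial>horizon T) = T * c" for c :: real
  using measure_horizon(1)[of 0 T T] by (simp add: space_restrict_space)

lemma integrable_const_horizon [simp, intro]: "integrable (horizon T) (\<lambda>_. c :: real)"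
  using finite_measure.integrable_const[OF finite_measure_horizon] .

text \<open>Both sides integrate $f_t \cdot g_s$ over the triangle $t \le s$.\<close>

lemma triangle_Fubini:
  fixes f g :: "real \<Rightarrow> 'b::euclidean_space"
  assumes f: "integrable (horizon T) f" and g: "integrable (horizon T) g"
  shows "(\<integral>t. (\<integral>s. indicator {t..T} s *\<^sub>R g s \<partial>horizon T) \<bullet> f t \<partial>horizon T)
      = (\<integral>s. g s \<bullet> (\<integral>t. indicator {0..s} t *\<^sub>R f t \<partial>horizon T) \<partial>horizon T)"
    and "integrable (horizon T) (\<lambda>t. (\<integral>s. indicator {t..T} s *\<^sub>R g s \<partial>horizon T) \<bullet> f t)"
    and "integrable (horizon T) (\<lambda>s. g s \<bullet> (\<integral>t. indicator {0..s} t *\<^sub>R f t \<partial>horizon T))"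
proof -
  interpret pair_sigma_finite "horizon T" "horizon T"
    by (simp add: pair_sigma_finite_def)
  note [measurable] = borel_measurable_integrable[OF f] borel_measurable_integrable[OF g]
  let ?k = "\<lambda>t s. indicator {t..T} s * (g s \<bullet> f t)"
  have i: "integrable (horizon T) (\<lambda>s. indicator {a..b} s *\<^sub>R h s)"
    if "integrable (horizon T) h" for h :: "real \<Rightarrow> 'b" and a b
  proof (rule Bochner_Integration.integrable_bound[OF that])
    have [measurable]: "h \<in> borel_measurable (horizon T)" using that by simp
    show "(\<lambda>s. indicator {a..b} s *\<^sub>R h s) \<in> borel_measurable (horizon T)" by measurable
  qed (auto split: split_indicator)
  have dom: "integrable (horizon T \<Otimes>\<^sub>M horizon T) (\<lambda>p. norm (f (fst p)) * norm (g (snd p)))"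
  proof (rule Fubini_integrable)
    show "integrable (horizon T) (\<lambda>x. \<integral>y. norm (norm (f (fst (x, y))) * norm (g (snd (x, y)))) \<partial>horizon T)"
      using f g by (simp add: abs_mult)
    show "AE x in horizon T. integrable (horizon T) (\<lambda>y. norm (f (fst (x, y))) * norm (g (snd (x, y))))"
      using g by simp
  qed measurable
  have k: "integrable (horizon T \<Otimes>\<^sub>M horizon T) (case_prod ?k)"
  proof (rule Bochner_Integration.integrable_bound[OF dom])
    show "(\<lambda>(t, s). ?k t s) \<in> borel_measurable (horizon T \<Otimes>\<^sub>M horizon T)"
      unfolding indicator_def atLeastAtMost_iff by measurable
    show "AE p in horizon T \<Otimes>\<^sub>M horizon T.
        norm (case p of (t, s) \<Rightarrow> ?k t s) \<le> norm (norm (f (fst p)) * norm (g (snd p)))"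
      by (intro AE_I2) (auto split: split_indicator
          simp: mult.commute[of "norm (f _)"] Cauchy_Schwarz_ineq2)
  qed
  have 1: "(\<integral>s. ?k t s \<partial>horizon T) = (\<integral>s. indicator {t..T} s *\<^sub>R g s \<partial>horizon T) \<bullet> f t" for t
    using integral_inner_left[OF i[OF g, of t T], of "f t"] by simp
  have 2: "(\<integral>t. ?k t s \<partial>horizon T) = g s \<bullet> (\<integral>t. indicator {0..s} t *\<^sub>R f t \<partial>horizon T)"
    if "s \<in> space (horizon T)" for s
  proof -
    have "(\<integral>t. ?k t s \<partial>horizon T) = (\<integral>t. g s \<bullet> (indicator {0..s} t *\<^sub>R f t) \<partial>horizon T)"
      using that by (intro Bochner_Integration.integral_cong)
        (auto simp: space_restrict_space split: split_indicator)
    also have "\<dots> = g s \<bullet> (\<integral>t. indicator {0..s} t *\<^sub>R f t \<partial>horizon T)"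
      using integral_inner_right[OF i[OF f, of 0 s], of "g s"] by simp
    finally show ?thesis .
  qed
  show "integrable (horizon T) (\<lambda>t. (\<integral>s. indicator {t..T} s *\<^sub>R g s \<partial>horizon T) \<bullet> f t)"
    using integrable_fst[OF k] by (simp add: 1)
  have "integrable (horizon T) (\<lambda>s. \<integral>t. ?k t s \<partial>horizon T)"
    using integrable_snd[OF k] by simp
  then show "integrable (horizon T) (\<lambda>s. g s \<bullet> (\<integral>t. indicator {0..s} t *\<^sub>R f t \<partial>horizon T))"
    by (subst (asm) Bochner_Integration.integrable_cong[OF refl 2])
  have "(\<integral>t. (\<integral>s. indicator {t..T} s *\<^sub>R g s \<partial>horizon T) \<bullet> f t \<partial>horizon T)
      = (\<integral>t. (\<integral>s. ?k t s \<partial>horizon T) \<partial>horizon T)"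
    by (simp add: 1)
  also have "\<dots> = (\<integral>s. (\<integral>t. ?k t s \<partial>horizon T) \<partial>horizon T)"
    using Fubini_integral[OF k] by simp
  also have "\<dots> = (\<integral>s. g s \<bullet> (\<integral>t. indicator {0..s} t *\<^sub>R f t \<partial>horizon T) \<partial>horizon T)"
    by (intro Bochner_Integration.integral_cong refl 2)
  finally show "(\<integral>t. (\<integral>s. indicator {t..T} s *\<^sub>R g s \<partial>horizon T) \<bullet> f t \<partial>horizon T)
      = (\<integral>s. g s \<bullet> (\<integral>t. indicator {0..s} t *\<^sub>R f t \<partial>horizon T) \<partial>horizon T)" .
qed

text \<open>The energy identity along one path.  The double integrals of $f_t \cdot g_s$ that come from
  $\int_0^s f$ in the second term and from $\int_t^T g$ in the third cancel, and so do the two terms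
  $\omega \cdot \int f$.\<close>

lemma path_duality:
  fixes f g :: "real \<Rightarrow> 'b::euclidean_space" and \<omega> x0 :: 'b
  assumes f: "integrable (horizon T) f" and g: "integrable (horizon T) g"
  shows "\<omega> \<bullet> (x0 - (\<integral>t. f t \<partial>horizon T))
    + (\<integral>s. g s \<bullet> (x0 - (\<integral>t. indicator {0..s} t *\<^sub>R f t \<partial>horizon T)) \<partial>horizon T)
    + (\<integral>t. (\<omega> + (\<integral>s. indicator {t..T} s *\<^sub>R g s \<partial>horizon T)) \<bullet> f t \<partial>horizon T)
    = (\<omega> + (\<integral>s. g s \<partial>horizon T)) \<bullet> x0"
  using triangle_Fubini[OF f g] f g
  by (simp add: inner_diff_right inner_add_left)

text \<open>The reason for an exponential weight: its mass before time \<open>s\<close> is at most its value at \<open>s\<close>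
  times the factor $1/K$, which is small for large $K$.\<close>

lemma integral_exp_weight_le:
  assumes "0 \<le> s" "s \<le> T" "K > 0" "c \<ge> 0"
  shows "(\<integral>t. indicator {0..s} t *\<^sub>R (c * exp (K * (t - T))) \<partial>horizon T) \<le> c * exp (K * (s - T)) / K"
proof -
  have "(\<integral>t. indicator {0..s} t *\<^sub>R (c * exp (K * (t - T))) \<partial>horizon T)
      = (LINT t:{0..s}|lborel. c * exp (K * (t - T)))"
    using assms by (subst set_integral_horizon[of 0 s T]) auto
  also have "\<dots> = c * exp (K * (s - T)) / K - c * exp (K * (0 - T)) / K"
    unfolding set_lebesgue_integral_def
    using assms
    by (intro integral_FTC_Icc[where F="\<lambda>t. c * exp (K * (t - T)) / K"])
       (auto intro!: derivative_eq_intros continuous_intros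
          simp: has_real_derivative_iff_has_vector_derivative[symmetric])
  finally show ?thesis using assms by simp
qed

section \<open>Square integrable processes\<close>

context prob_space
begin

lemma pair_sigma_finite_horizon: "pair_sigma_finite (horizon T) M"
  by (simp add: pair_sigma_finite_def prob_space_imp_sigma_finite prob_space_axioms)

lemma process_path_measurable:
  "case_prod f \<in> borel_measurable (time_prod {0..T} M) \<Longrightarrow> w \<in> space M \<Longrightarrow>
    (\<lambda>s. f s w) \<in> borel_measurable (horizon T)"
  using measurable_compose[OF measurable_Pair2'[of w M "horizon T"], of "case_prod f" borel]
  by (simp add: time_prod_def)

lemma process_inner:
  fixes u v :: "real \<Rightarrow> 'a \<Rightarrow> 'b::euclidean_space"
  assumes u: "case_prod u \<in> L2 (time_prod {0..T} M)" and v: "case_prod v \<in> L2 (time_prod {0..T} M)"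
  shows "integrable (horizon T) (\<lambda>s. L2inner M (u s) (v s))"
    and "integrable M (\<lambda>w. \<integral>s. u s w \<bullet> v s w \<partial>horizon T)"
    and "(\<integral>w. (\<integral>s. u s w \<bullet> v s w \<partial>horizon T) \<partial>M) = (\<integral>s. L2inner M (u s) (v s) \<partial>horizon T)"
proof -
  interpret pair_sigma_finite "horizon T" M by (rule pair_sigma_finite_horizon)
  have i: "integrable (horizon T \<Otimes>\<^sub>M M) (case_prod (\<lambda>s w. u s w \<bullet> v s w))"
    using L2_integrable_inner[OF u v] by (simp add: time_prod_def case_prod_beta')
  show "integrable (horizon T) (\<lambda>s. L2inner M (u s) (v s))"
    using integrable_fst[OF i] by (simp add: L2inner_def)
  show "integrable M (\<lambda>w. \<integral>s. u s w \<bullet> v s w \<partial>horizon T)"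
    using integrable_snd[OF i] by simp
  show "(\<integral>w. (\<integral>s. u s w \<bullet> v s w \<partial>horizon T) \<partial>M) = (\<integral>s. L2inner M (u s) (v s) \<partial>horizon T)"
    unfolding L2inner_def by (rule Fubini_integral[OF i])
qed

lemma process_norm:
  fixes u :: "real \<Rightarrow> 'a \<Rightarrow> 'b::euclidean_space"
  assumes u: "case_prod u \<in> L2 (time_prod {0..T} M)"
  shows "integrable (horizon T) (\<lambda>s. (L2norm M (u s))\<^sup>2)"
    and "AE w in M. (\<lambda>s. u s w) \<in> L2 (horizon T)"
proof -
  interpret pair_sigma_finite "horizon T" M by (rule pair_sigma_finite_horizon)
  show "integrable (horizon T) (\<lambda>s. (L2norm M (u s))\<^sup>2)"
    using process_inner(1)[OF u u] by (simp add: L2inner_def L2norm_power2 power2_norm_eq_inner)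
  have i: "integrable (horizon T \<Otimes>\<^sub>M M) (case_prod (\<lambda>s w. (norm (u s w))\<^sup>2))"
    using L2_integrable_norm_power2[OF u] by (simp add: time_prod_def case_prod_beta')
  have "AE w in M. integrable (horizon T) (\<lambda>s. (norm (u s w))\<^sup>2)"
    using AE_integrable_snd[OF i] by simp
  with AE_space show "AE w in M. (\<lambda>s. u s w) \<in> L2 (horizon T)"
    by eventually_elim (use process_path_measurable[OF L2_measurable[OF u]] in \<open>auto simp: L2_def\<close>)
qed

text \<open>Joint square integrability by Tonelli's theorem from a bound on the norm at each time.\<close>

lemma process_L2I:
  fixes u :: "real \<Rightarrow> 'a \<Rightarrow> 'b::euclidean_space"
  assumes m: "case_prod u \<in> borel_measurable (time_prod {0..T} M)"
    and L: "\<And>s. s \<in> {0..T} \<Longrightarrow> u s \<in> L2 M"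
    and b: "\<And>s. s \<in> {0..T} \<Longrightarrow> (L2norm M (u s))\<^sup>2 \<le> h s"
    and h: "integrable (horizon T) h"
  shows "case_prod u \<in> L2 (time_prod {0..T} M)"
proof -
  interpret pair_sigma_finite "horizon T" M by (rule pair_sigma_finite_horizon)
  note m' [measurable] = m[unfolded time_prod_def]
  have "integrable (horizon T \<Otimes>\<^sub>M M) (\<lambda>p. (norm (case_prod u p))\<^sup>2)"
  proof (rule Fubini_integrable)
    have "integrable (horizon T) (\<lambda>s. (L2norm M (u s))\<^sup>2)"
    proof (rule Bochner_Integration.integrable_bound[OF h])
      have "(\<lambda>s. \<integral>w. (norm (case_prod u (s, w)))\<^sup>2 \<partial>M) \<in> borel_measurable (horizon T)"
        by measurable
      then show "(\<lambda>s. (L2norm M (u s))\<^sup>2) \<in> borel_measurable (horizon T)"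
        by (simp add: L2norm_power2)
      show "AE s in horizon T. norm ((L2norm M (u s))\<^sup>2) \<le> norm (h s)"
        using b by (intro AE_I2) (auto simp: space_restrict_space intro: order_trans[OF _ abs_ge_self])
    qed
    then show "integrable (horizon T) (\<lambda>s. \<integral>w. norm ((norm (case_prod u (s, w)))\<^sup>2) \<partial>M)"
      by (simp add: L2norm_power2)
    show "AE s in horizon T. integrable M (\<lambda>w. (norm (case_prod u (s, w)))\<^sup>2)"
      using L[THEN L2_integrable_norm_power2] by (intro AE_I2) (auto simp: space_restrict_space)
  qed measurable
  then show ?thesis using m by (simp add: L2_def time_prod_def)
qed

text \<open>The pathwise bound holds for almost every path only, those that are square integrable in
  time.\<close>

lemma time_integral_L2:
  fixes f :: "real \<Rightarrow> 'a \<Rightarrow> 'b::euclidean_space"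
  assumes f: "case_prod f \<in> L2 (time_prod {0..T} M)" and A [measurable]: "A \<in> sets (horizon T)"
  defines "J \<equiv> \<lambda>w. \<integral>s. indicator A s *\<^sub>R f s w \<partial>horizon T"
  shows "J \<in> L2 M"
    and "(L2norm M J)\<^sup>2 \<le> measure (horizon T) A * (\<integral>s. indicator A s * (L2norm M (f s))\<^sup>2 \<partial>horizon T)"
proof -
  interpret pair_sigma_finite "horizon T" M by (rule pair_sigma_finite_horizon)
  note m [measurable] = L2_measurable[OF f, unfolded time_prod_def]
  let ?u = "\<lambda>s w. indicator A s *\<^sub>R f s w"
  have u: "case_prod ?u \<in> L2 (time_prod {0..T} M)"
  proof (rule L2I_bound[OF _ L2_integrable_norm_power2[OF f]])
    have "(\<lambda>p. indicator A (fst p) *\<^sub>R case_prod f p) \<in> borel_measurable (horizon T \<Otimes>\<^sub>M M)"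
      by measurable
    then show "case_prod ?u \<in> borel_measurable (time_prod {0..T} M)"
      by (simp add: time_prod_def case_prod_beta')
  qed (auto split: split_indicator)
  have Jm: "J \<in> borel_measurable M"
  proof -
    have "case_prod (\<lambda>w s. ?u s w) \<in> borel_measurable (M \<Otimes>\<^sub>M horizon T)"
      using measurable_pair_swap[OF L2_measurable[OF u, unfolded time_prod_def]]
      by (simp add: case_prod_beta')
    then show ?thesis unfolding J_def
      by (rule sigma_finite_measure.borel_measurable_lebesgue_integral[OF sigma_finite_horizon])
  qed
  have bd: "AE w in M. (norm (J w))\<^sup>2 \<le> measure (horizon T) A * (\<integral>s. ?u s w \<bullet> ?u s w \<partial>horizon T)"
    using process_norm(2)[OF f]
  proof eventually_elim
    case (elim w)
    have "(norm (J w))\<^sup>2 \<le> measure (horizon T) A * (\<integral>s. indicator A s * (norm (f s w))\<^sup>2 \<partial>horizon T)"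
      using norm_integral_indicator_power2_le(1)[OF elim A measure_horizon(3)]
      by (simp add: J_def)
    also have "(\<integral>s. indicator A s * (norm (f s w))\<^sup>2 \<partial>horizon T) = (\<integral>s. ?u s w \<bullet> ?u s w \<partial>horizon T)"
      by (intro Bochner_Integration.integral_cong) (auto simp: power2_norm_eq_inner split: split_indicator)
    finally show ?case .
  qed
  have i: "integrable M (\<lambda>w. measure (horizon T) A * (\<integral>s. ?u s w \<bullet> ?u s w \<partial>horizon T))"
    using process_inner(2)[OF u u] by simp
  show J: "J \<in> L2 M" by (rule L2I_bound[OF Jm i bd])
  have "(L2norm M J)\<^sup>2 \<le> (\<integral>w. measure (horizon T) A * (\<integral>s. ?u s w \<bullet> ?u s w \<partial>horizon T) \<partial>M)"
    unfolding L2norm_power2 by (rule integral_mono_AE[OF L2_integrable_norm_power2[OF J] i bd])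
  also have "\<dots> = measure (horizon T) A * (\<integral>s. L2inner M (?u s) (?u s) \<partial>horizon T)"
    using process_inner(3)[OF u u] by simp
  also have "(\<integral>s. L2inner M (?u s) (?u s) \<partial>horizon T)
      = (\<integral>s. indicator A s * (L2norm M (f s))\<^sup>2 \<partial>horizon T)"
    by (intro Bochner_Integration.integral_cong)
      (auto simp: L2inner_def L2norm_power2 power2_norm_eq_inner split: split_indicator)
  finally show "(L2norm M J)\<^sup>2 \<le> measure (horizon T) A * (\<integral>s. indicator A s * (L2norm M (f s))\<^sup>2 \<partial>horizon T)" .
qed

lemma running_integral_L2:
  fixes f :: "real \<Rightarrow> 'a \<Rightarrow> 'b::euclidean_space"
  assumes f: "case_prod f \<in> L2 (time_prod {0..T} M)"
  shows "(\<lambda>(t, w). \<integral>s. indicator {0..t} s *\<^sub>R f s w \<partial>horizon T) \<in> L2 (time_prod {0..T} M)"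
    and "(\<lambda>(t, w). \<integral>s. indicator {t..T} s *\<^sub>R f s w \<partial>horizon T) \<in> L2 (time_prod {0..T} M)"
proof -
  note m [measurable] = L2_measurable[OF f, unfolded time_prod_def]
  note n = process_norm(1)[OF f]
  let ?S = "\<integral>s. (L2norm M (f s))\<^sup>2 \<partial>horizon T"
  have le: "(\<integral>s. indicator {a..b} s * (L2norm M (f s))\<^sup>2 \<partial>horizon T) \<le> ?S" for a b
  proof (rule integral_mono)
    have [measurable]: "(\<lambda>s. (L2norm M (f s))\<^sup>2) \<in> borel_measurable (horizon T)" using n by simp
    show "integrable (horizon T) (\<lambda>s. indicator {a..b} s * (L2norm M (f s))\<^sup>2)"
      by (rule Bochner_Integration.integrable_bound[OF n]) (measurable, auto split: split_indicator)
  qed (use n in \<open>auto split: split_indicator\<close>)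
  have S: "0 \<le> ?S" by simp
  have bound: "(L2norm M (\<lambda>w. \<integral>s. indicator {a..b} s *\<^sub>R f s w \<partial>horizon T))\<^sup>2 \<le> T * ?S"
    if "0 \<le> a" "a \<le> b" "b \<le> T" for a b
  proof -
    have "{a..b} \<in> sets (horizon T)" "measure (horizon T) {a..b} \<le> T"
      using that by (auto simp: measure_horizon)
    then show ?thesis
      using S that by (intro order_trans[OF time_integral_L2(2)[OF f]] mult_mono le)
        (auto intro!: Bochner_Integration.integral_nonneg)
  qed
  show "(\<lambda>(t, w). \<integral>s. indicator {0..t} s *\<^sub>R f s w \<partial>horizon T) \<in> L2 (time_prod {0..T} M)"
  proof (rule process_L2I[where h = "\<lambda>_. T * ?S"])
    have "(\<lambda>(p, s). indicator {0..fst p} s *\<^sub>R case_prod f (s, snd p))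
        \<in> borel_measurable ((horizon T \<Otimes>\<^sub>M M) \<Otimes>\<^sub>M horizon T)"
      unfolding indicator_def atLeastAtMost_iff by measurable
    then have "(\<lambda>p. \<integral>s. indicator {0..fst p} s *\<^sub>R case_prod f (s, snd p) \<partial>horizon T)
        \<in> borel_measurable (horizon T \<Otimes>\<^sub>M M)"
      by (rule sigma_finite_measure.borel_measurable_lebesgue_integral[OF sigma_finite_horizon])
    then show "(\<lambda>(t, w). \<integral>s. indicator {0..t} s *\<^sub>R f s w \<partial>horizon T)
        \<in> borel_measurable (time_prod {0..T} M)"
      by (simp add: time_prod_def case_prod_beta')
  qed (use bound in \<open>auto intro!: time_integral_L2(1)[OF f] measure_horizon(2)\<close>)
  show "(\<lambda>(t, w). \<integral>s. indicator {t..T} s *\<^sub>R f s w \<partial>horizon T) \<in> L2 (time_prod {0..T} M)"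
  proof (rule process_L2I[where h = "\<lambda>_. T * ?S"])
    have "(\<lambda>(p, s). indicator {fst p..T} s *\<^sub>R case_prod f (s, snd p))
        \<in> borel_measurable ((horizon T \<Otimes>\<^sub>M M) \<Otimes>\<^sub>M horizon T)"
      unfolding indicator_def atLeastAtMost_iff by measurable
    then have "(\<lambda>p. \<integral>s. indicator {fst p..T} s *\<^sub>R case_prod f (s, snd p) \<partial>horizon T)
        \<in> borel_measurable (horizon T \<Otimes>\<^sub>M M)"
      by (rule sigma_finite_measure.borel_measurable_lebesgue_integral[OF sigma_finite_horizon])
    then show "(\<lambda>(t, w). \<integral>s. indicator {t..T} s *\<^sub>R f s w \<partial>horizon T)
        \<in> borel_measurable (time_prod {0..T} M)"
      by (simp add: time_prod_def case_prod_beta')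
  qed (use bound in \<open>auto intro!: time_integral_L2(1)[OF f] measure_horizon(2)\<close>)
qed

lemma constant_process_L2:
  assumes "Y \<in> L2 M"
  shows "(\<lambda>(t, w). Y w) \<in> L2 (time_prod {0..T} M)"
proof (rule process_L2I[where h="\<lambda>_. (L2norm M Y)\<^sup>2"])
  show "(\<lambda>(t, w). Y w) \<in> borel_measurable (time_prod {0..T} M)"
    using L2_measurable[OF assms] unfolding time_prod_def by measurable
qed (use assms in auto)

text \<open>The expectation of \<open>path_duality\<close>.  It involves $V$, which need not be adapted; for the solution
  of the system, $\langle V_t, f_t\rangle = \langle W_t, f_t\rangle$.\<close>

lemma duality:
  fixes f g :: "real \<Rightarrow> 'a \<Rightarrow> 'b::euclidean_space"
  assumes T: "0 \<le> T"
    and f: "case_prod f \<in> L2 (time_prod {0..T} M)" and g: "case_prod g \<in> L2 (time_prod {0..T} M)"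
    and \<omega>: "\<omega> \<in> L2 M" and x0: "x0 \<in> L2 M"
  defines "X \<equiv> \<lambda>t w. x0 w - (\<integral>s. indicator {0..t} s *\<^sub>R f s w \<partial>horizon T)"
    and "V \<equiv> \<lambda>t w. \<omega> w + (\<integral>s. indicator {t..T} s *\<^sub>R g s w \<partial>horizon T)"
  shows "L2inner M \<omega> (X T) + (\<integral>t. L2inner M (g t) (X t) + L2inner M (V t) (f t) \<partial>horizon T)
    = L2inner M (V 0) x0"
    and "case_prod X \<in> L2 (time_prod {0..T} M)"
    and "integrable (horizon T) (\<lambda>t. L2inner M (g t) (X t) + L2inner M (V t) (f t))"
proof -
  show X: "case_prod X \<in> L2 (time_prod {0..T} M)"
    using L2_diff(1)[OF constant_process_L2[OF x0] running_integral_L2(1)[OF f]]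
    by (simp add: X_def case_prod_beta')
  have V: "case_prod V \<in> L2 (time_prod {0..T} M)"
    using L2_add(1)[OF constant_process_L2[OF \<omega>] running_integral_L2(2)[OF g]]
    by (simp add: V_def case_prod_beta')
  have XT: "X T \<in> L2 M" and V0: "V 0 \<in> L2 M"
    unfolding X_def V_def using T
    by (auto intro!: L2_diff L2_add x0 \<omega> time_integral_L2(1)[OF f] time_integral_L2(1)[OF g] measure_horizon)
  have path: "AE w in M. \<omega> w \<bullet> X T w
      + (\<integral>s. g s w \<bullet> X s w \<partial>horizon T) + (\<integral>t. V t w \<bullet> f t w \<partial>horizon T) = V 0 w \<bullet> x0 w"
    using process_norm(2)[OF f] process_norm(2)[OF g]
  proof eventually_elim
    case (elim w)
    have i: "integrable (horizon T) h"
      if "h \<in> L2 (horizon T)" for h :: "real \<Rightarrow> 'b"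
    proof -
      have "integrable (horizon T) (\<lambda>s. indicator {0..T} s *\<^sub>R h s)"
        by (rule norm_integral_indicator_power2_le(2)[OF that measure_horizon(2,3)]) simp_all
      then show ?thesis
        by (rule Bochner_Integration.integrable_cong[THEN iffD1, rotated -1])
          (auto simp: space_restrict_space)
    qed
    have full: "(\<integral>s. indicator {0..T} s *\<^sub>R h s \<partial>horizon T) = (\<integral>s. h s \<partial>horizon T)"
      for h :: "real \<Rightarrow> 'b"
      by (intro Bochner_Integration.integral_cong) (auto simp: space_restrict_space)
    show ?case
      using path_duality[OF i[OF elim(1)] i[OF elim(2)], of "\<omega> w" "x0 w"]
      unfolding X_def V_def full .
  qed
  note i = L2_integrable_inner[OF \<omega> XT] process_inner(2)[OF g X] process_inner(2)[OF V f]
  have "L2inner M (V 0) x0 = (\<integral>w. \<omega> w \<bullet> X T w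
      + (\<integral>s. g s w \<bullet> X s w \<partial>horizon T) + (\<integral>t. V t w \<bullet> f t w \<partial>horizon T) \<partial>M)"
    unfolding L2inner_def[of _ "V 0"]
    by (rule integral_cong_AE)
      (use path i L2_integrable_inner[OF V0 x0] in \<open>auto intro!: borel_measurable_add dest: borel_measurable_integrable\<close>)
  also have "\<dots> = L2inner M \<omega> (X T) + (\<integral>w. (\<integral>s. g s w \<bullet> X s w \<partial>horizon T) \<partial>M)
      + (\<integral>w. (\<integral>t. V t w \<bullet> f t w \<partial>horizon T) \<partial>M)"
    using i by (simp add: L2inner_def)
  also have "\<dots> = L2inner M \<omega> (X T) + (\<integral>t. L2inner M (g t) (X t) + L2inner M (V t) (f t) \<partial>horizon T)"
    unfolding process_inner(3)[OF g X] process_inner(3)[OF V f]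
    using process_inner(1)[OF g X] process_inner(1)[OF V f] by simp
  finally show "L2inner M \<omega> (X T) + (\<integral>t. L2inner M (g t) (X t) + L2inner M (V t) (f t) \<partial>horizon T)
    = L2inner M (V 0) x0" ..
  show "integrable (horizon T) (\<lambda>t. L2inner M (g t) (X t) + L2inner M (V t) (f t))"
    using process_inner(1)[OF g X] process_inner(1)[OF V f] by simp
qed

end

section \<open>The estimate for the norms\<close>

text \<open>Here \<open>n\<close> and \<open>x\<close> stand for $\|W_t\|^2$ and $\|X'_t\|^2$.  Multiply the bound on \<open>n\<close> by
  $\theta$ and integrate; exchanging the order of integration puts $\int_0^s\theta \le \theta(s)/K$ in
  front of $\gamma(s) \le k(1 + x + n)$, and for $4Tk \le K$ the resulting $\int\theta n$ is absorbed on
  the left.  The point, compared with the usual Gronwall bound, is the factor $1/K$ in front of \<open>x\<close>.\<close>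

lemma weighted_Gronwall:
  fixes n x \<gamma> :: "real \<Rightarrow> real"
  assumes c: "0 < T" "0 \<le> k" "0 < K" "4 * T * k \<le> K" "0 \<le> \<theta>0" "0 \<le> A"
    and int: "integrable (horizon T) n" "integrable (horizon T) x" "integrable (horizon T) \<gamma>"
    and nn: "\<And>t. t \<in> {0..T} \<Longrightarrow> 0 \<le> \<gamma> t" "\<And>t. t \<in> {0..T} \<Longrightarrow> 0 \<le> n t"
    and growth: "\<And>t. t \<in> {0..T} \<Longrightarrow> \<gamma> t \<le> k * (1 + x t + n t)"
    and n: "\<And>t. t \<in> {0..T} \<Longrightarrow> n t \<le> 2 * A + 2 * T * (\<integral>s. indicator {t..T} s *\<^sub>R \<gamma> s \<partial>horizon T)"
  defines "\<theta> \<equiv> \<lambda>s. \<theta>0 * exp (K * (s - T))"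
  shows "(\<integral>t. \<theta> t * n t \<partial>horizon T)
      \<le> 4 * A * (\<integral>t. \<theta> t \<partial>horizon T)
        + 4 * T * k / K * ((\<integral>t. \<theta> t \<partial>horizon T) + (\<integral>t. \<theta> t * x t \<partial>horizon T))"
proof -
  have \<theta>b: "0 \<le> \<theta> t" "\<theta> t \<le> \<theta>0" if "t \<in> {0..T}" for t
    using that c by (auto simp: \<theta>_def mult_nonneg_nonpos intro!: mult_left_le)
  have [measurable]: "\<theta> \<in> borel_measurable (horizon T)" unfolding \<theta>_def by measurable
  have i: "integrable (horizon T) (\<lambda>t. \<theta> t * h t)" if "integrable (horizon T) h" for h
  proof (rule Bochner_Integration.integrable_bound)
    show "integrable (horizon T) (\<lambda>t. \<theta>0 * h t)" using that by simp
    show "(\<lambda>t. \<theta> t * h t) \<in> borel_measurable (horizon T)"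
      using borel_measurable_integrable[OF that] by measurable
    show "AE t in horizon T. norm (\<theta> t * h t) \<le> norm (\<theta>0 * h t)"
      using \<theta>b c by (intro AE_I2) (auto simp: space_restrict_space abs_mult intro!: mult_right_mono)
  qed
  have i\<theta>: "integrable (horizon T) \<theta>" using i[of "\<lambda>_. 1"] by simp
  note tri = triangle_Fubini[OF i\<theta> int(3)]
  let ?\<Theta> = "\<integral>t. \<theta> t \<partial>horizon T" and ?N = "\<integral>t. \<theta> t * n t \<partial>horizon T"
    and ?X = "\<integral>t. \<theta> t * x t \<partial>horizon T"
  have "?N \<le> (\<integral>t. 2 * A * \<theta> t + 2 * T * ((\<integral>s. indicator {t..T} s *\<^sub>R \<gamma> s \<partial>horizon T) \<bullet> \<theta> t) \<partial>horizon T)"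
  proof (rule integral_mono)
    fix t assume "t \<in> space (horizon T)"
    then have t: "t \<in> {0..T}" by (simp add: space_restrict_space)
    show "\<theta> t * n t \<le> 2 * A * \<theta> t + 2 * T * ((\<integral>s. indicator {t..T} s *\<^sub>R \<gamma> s \<partial>horizon T) \<bullet> \<theta> t)"
      using mult_left_mono[OF n[OF t] \<theta>b(1)[OF t]] by (simp add: algebra_simps)
  qed (use i[OF int(1)] i\<theta> tri(2) in auto)
  also have "\<dots> = 2 * A * ?\<Theta> + 2 * T * (\<integral>s. \<gamma> s \<bullet> (\<integral>t. indicator {0..s} t *\<^sub>R \<theta> t \<partial>horizon T) \<partial>horizon T)"
    using i\<theta> tri(2) unfolding tri(1)[symmetric] by simp
  also have "(\<integral>s. \<gamma> s \<bullet> (\<integral>t. indicator {0..s} t *\<^sub>R \<theta> t \<partial>horizon T) \<partial>horizon T)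
      \<le> (\<integral>s. k / K * (\<theta> s + \<theta> s * x s + \<theta> s * n s) \<partial>horizon T)"
  proof (rule integral_mono[OF tri(3)])
    fix s assume "s \<in> space (horizon T)"
    then have s: "s \<in> {0..T}" by (simp add: space_restrict_space)
    have "\<gamma> s \<bullet> (\<integral>t. indicator {0..s} t *\<^sub>R \<theta> t \<partial>horizon T) \<le> \<gamma> s * (\<theta> s / K)"
      unfolding \<theta>_def using mult_left_mono[OF integral_exp_weight_le[of s T K \<theta>0] nn(1)[OF s]] s c
      by simp
    also have "\<dots> \<le> k * (1 + x s + n s) * (\<theta> s / K)"
      using growth[OF s] \<theta>b(1)[OF s] c by (intro mult_right_mono) auto
    also have "\<dots> = k / K * (\<theta> s + \<theta> s * x s + \<theta> s * n s)" by (simp add: algebra_simps)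
    finally show "\<gamma> s \<bullet> (\<integral>t. indicator {0..s} t *\<^sub>R \<theta> t \<partial>horizon T)
      \<le> k / K * (\<theta> s + \<theta> s * x s + \<theta> s * n s)" .
  qed (use i[OF int(1)] i[OF int(2)] i\<theta> in auto)
  also have "(\<integral>s. k / K * (\<theta> s + \<theta> s * x s + \<theta> s * n s) \<partial>horizon T) = k / K * (?\<Theta> + ?X + ?N)"
    using i[OF int(1)] i[OF int(2)] i\<theta> by simp
  finally have main: "?N \<le> 2 * A * ?\<Theta> + 2 * T * (k / K * (?\<Theta> + ?X + ?N))"
    using c by simp
  have N0: "0 \<le> ?N"
    using \<theta>b nn by (intro Bochner_Integration.integral_nonneg) (auto simp: space_restrict_space)
  have "2 * T * (k / K) * ?N \<le> 1 / 2 * ?N"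
    using c N0 by (intro mult_right_mono) (auto simp: field_simps)
  moreover have "2 * T * (k / K * (?\<Theta> + ?X + ?N))
      = 2 * T * (k / K) * (?\<Theta> + ?X) + 2 * T * (k / K) * ?N"
    by (simp only: algebra_simps)
  ultimately have "?N \<le> 2 * (2 * A * ?\<Theta>) + 2 * (2 * T * (k / K) * (?\<Theta> + ?X))"
    using main by linarith
  then show ?thesis by simp
qed

text \<open>What the equations and the monotonicity say about the deterministic functions
  $x = \|X'\|^2$, $n = \|W\|^2$, $\phi = \|f\|^2$, $\gamma = \|g\|^2$, the integrand \<open>e\<close> of the energy
  identity, $A = \|\omega\|^2$, $D = \langle\omega, X'_T\rangle$ and the datum $\|X_0\|^2$ (here \<open>x0\<close>).  The
  conjuncts with $\eta$ come from Young's inequality and hold for all $\eta$ because $\eta$ is chosen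
  only at the very end.\<close>

definition energy_system :: "real \<Rightarrow> real \<Rightarrow> real \<Rightarrow> real \<Rightarrow> real \<Rightarrow> (real \<Rightarrow> real) \<Rightarrow> (real \<Rightarrow> real) \<Rightarrow>
    (real \<Rightarrow> real) \<Rightarrow> (real \<Rightarrow> real) \<Rightarrow> (real \<Rightarrow> real) \<Rightarrow> real \<Rightarrow> real \<Rightarrow> real \<Rightarrow> bool" where
  "energy_system T \<alpha> L a0 k x n \<phi> \<gamma> e A x0 D \<longleftrightarrow>
    (\<forall>h\<in>{x, n, \<phi>, \<gamma>, e}. integrable (horizon T) h) \<and>
    (\<forall>t\<in>{0..T}. 0 \<le> x t \<and> 0 \<le> n t \<and> 0 \<le> \<phi> t \<and> 0 \<le> \<gamma> t \<and>
      \<phi> t \<le> k * (1 + x t + n t) \<and> \<gamma> t \<le> k * (1 + x t + n t) \<and>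
      x t \<le> 2 * x0 + 2 * T * (\<integral>s. indicator {0..t} s *\<^sub>R \<phi> s \<partial>horizon T) \<and>
      n t \<le> 2 * A + 2 * T * (\<integral>s. indicator {t..T} s *\<^sub>R \<gamma> s \<partial>horizon T) \<and>
      (\<forall>\<theta>\<in>{0..1}. \<forall>\<eta>>0. \<theta> * (\<alpha> * x t - L * n t) - \<eta> * (x t + n t) - k / \<eta> \<le> e t)) \<and>
    0 \<le> A \<and> 0 \<le> x0 \<and>
    (\<forall>\<eta>>0. a0 / 2 * A - k - \<eta> * x T - k / \<eta> \<le> D) \<and>
    (\<forall>\<eta>>0. D + (\<integral>t. e t \<partial>horizon T) \<le> \<eta> * (2 * A + 2 * T * (\<integral>t. \<gamma> t \<partial>horizon T)) + x0 / \<eta>)"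

text \<open>The order in which the constants are fixed matters.  $K$ comes first, so large that
  $L\int\theta n$ costs at most $\frac\alpha2\int\theta x$, up to a constant and a multiple of $A$; then
  $\theta_0$, so small that this multiple is at most $\frac{a_0}4 A$; the weight is then bounded below
  by some $\theta_m > 0$, so that unweighted integrals are controlled by weighted ones at a fixed cost;
  finally $\eta$ is so small that
  all terms multiplied by it are absorbed, up to a multiple of $1 + x_0$, by what is left of
  $\frac{a_0}2 A$ and $\alpha\int\theta x$.\<close>

lemma a_priori_bound:
  fixes T \<alpha> L a0 k :: real
  assumes T: "0 < T" and \<alpha>: "0 < \<alpha>" and L: "0 \<le> L" and a0: "0 < a0" and k: "0 \<le> k"
  shows "\<exists>C\<ge>0. \<forall>x n \<phi> \<gamma> e A x0 D. energy_system T \<alpha> L a0 k x n \<phi> \<gamma> e A x0 D \<longrightarrow>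
    (\<forall>t\<in>{0..T}. x t \<le> C * (1 + x0) \<and> n t \<le> C * (1 + x0))"
proof -
  define K where "K = 4 * T * k + 8 * T * k * L / \<alpha> + 1"
  define \<theta>0 where "\<theta>0 = a0 / (a0 + 16 * L * T)"
  define \<theta>m where "\<theta>m = \<theta>0 * exp (- K * T)"
  \<comment> \<open>The factor of $\eta$ in the energy inequality is at most $2x_0 + c_0 + c_1 A + c_2\int\theta x$.\<close>
  define c0 where "c0 = 4 * T\<^sup>2 * k + (4 * T * k + 1) * T / \<theta>m"
  define c1 where "c1 = 2 + (4 * T * k + 1) * 4 * T / \<theta>m"
  define c2 where "c2 = (4 * T * k + 1) * 2 / \<theta>m"
  define \<eta> where "\<eta> = min (a0 / (8 * c1)) (\<alpha> / (4 * c2))"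
  define c3 where "c3 = k + \<alpha> * T / 2 + (k + T * k) / \<eta> + \<eta> * c0"
  define c4 where "c4 = 1 / \<eta> + 2 * \<eta>"
  \<comment> \<open>These bound $A$, $\int\theta x$ and $\int x + n$, each as a multiple of $1 + x_0$.\<close>
  define cA where "cA = 8 / a0 * (c3 + c4)"
  define cX where "cX = 4 / \<alpha> * (c3 + c4)"
  define cS where "cS = (2 * cX + 4 * T * cA + T) / \<theta>m"
  define C where "C = 2 + 2 * cA + 2 * T * k * (T + cS)"
  have K: "0 < K" "4 * T * k \<le> K" "4 * T * k / K \<le> 1" "L * (4 * T * k / K) \<le> \<alpha> / 2"
  proof -
    have p: "0 \<le> T * k" "0 \<le> 8 * T * k * L / \<alpha>" using T k L \<alpha> by auto
    then show K: "0 < K" "4 * T * k \<le> K" by (auto simp: K_def)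
    then show "4 * T * k / K \<le> 1" by simp
    have "L * (4 * T * k) \<le> \<alpha> / 2 * (8 * T * k * L / \<alpha>)" using \<alpha> by simp
    also have "\<dots> \<le> \<alpha> / 2 * K" using p \<alpha> by (intro mult_left_mono) (auto simp: K_def)
    finally show "L * (4 * T * k / K) \<le> \<alpha> / 2" using K by (simp add: pos_divide_le_eq)
  qed
  have LT: "0 \<le> L * T" using L T by simp
  have \<theta>0: "0 < \<theta>0" "\<theta>0 \<le> 1" "4 * L * T * \<theta>0 \<le> a0 / 4"
  proof -
    have p: "0 < a0 + 16 * L * T" using a0 LT by linarith
    show "0 < \<theta>0" "\<theta>0 \<le> 1" using p a0 LT by (auto simp: \<theta>0_def)
    have "4 * L * T * a0 \<le> a0 / 4 * (a0 + 16 * L * T)" using a0 by (simp add: algebra_simps)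
    then show "4 * L * T * \<theta>0 \<le> a0 / 4" using p by (simp add: \<theta>0_def pos_divide_le_eq)
  qed
  have \<theta>m: "0 < \<theta>m" using \<theta>0 by (simp add: \<theta>m_def)
  have Tk: "0 \<le> T * k" using T k by simp
  have c: "0 \<le> c0" "0 < c1" "0 < c2"
  proof -
    have p: "0 < 4 * T * k + 1" using Tk by linarith
    have "0 \<le> (4 * T * k + 1) * T / \<theta>m" "0 \<le> 4 * T\<^sup>2 * k" "0 \<le> (4 * T * k + 1) * 4 * T / \<theta>m"
      "0 < (4 * T * k + 1) * 2 / \<theta>m"
      using p T k \<theta>m by simp_all
    then show "0 \<le> c0" "0 < c1" "0 < c2" unfolding c0_def c1_def c2_def by linarith+
  qed
  have \<eta>: "0 < \<eta>" "\<eta> * c1 \<le> a0 / 8" "\<eta> * c2 \<le> \<alpha> / 4"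
  proof -
    show "0 < \<eta>" using c a0 \<alpha> by (simp add: \<eta>_def)
    have "\<eta> * c1 \<le> a0 / (8 * c1) * c1" using c by (intro mult_right_mono) (auto simp: \<eta>_def)
    then show "\<eta> * c1 \<le> a0 / 8" using c by simp
    have "\<eta> * c2 \<le> \<alpha> / (4 * c2) * c2" using c by (intro mult_right_mono) (auto simp: \<eta>_def)
    then show "\<eta> * c2 \<le> \<alpha> / 4" using c by simp
  qed
  have c34: "0 \<le> c3" "0 \<le> c4" using \<eta> c k T \<alpha> Tk by (auto simp: c3_def c4_def)
  have cAX: "0 \<le> cA" "0 \<le> cX" using c34 a0 \<alpha> by (auto simp: cA_def cX_def)
  have cS: "0 \<le> cS" using cAX T \<theta>m by (simp add: cS_def)
  have C0: "0 \<le> C" using cAX cS T Tk by (simp add: C_def)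
  have key: "x t \<le> C * (1 + x0) \<and> n t \<le> C * (1 + x0)"
    if E: "energy_system T \<alpha> L a0 k x n \<phi> \<gamma> e A x0 D" and t: "t \<in> {0..T}"
    for x n \<phi> \<gamma> e A x0 D t
  proof -
    note E' = E[unfolded energy_system_def]
    have int: "integrable (horizon T) x" "integrable (horizon T) n" "integrable (horizon T) \<phi>"
      "integrable (horizon T) \<gamma>" "integrable (horizon T) e" using E' by auto
    have nn: "0 \<le> x s" "0 \<le> n s" "0 \<le> \<phi> s" "0 \<le> \<gamma> s" if "s \<in> {0..T}" for s
      using E' that by auto
    have gr: "\<phi> s \<le> k * (1 + x s + n s)" "\<gamma> s \<le> k * (1 + x s + n s)" if "s \<in> {0..T}" for s
      using E' that by auto
    have xb: "x s \<le> 2 * x0 + 2 * T * (\<integral>r. indicator {0..s} r *\<^sub>R \<phi> r \<partial>horizon T)" if "s \<in> {0..T}" for s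
      using E' that by auto
    have nb: "n s \<le> 2 * A + 2 * T * (\<integral>r. indicator {s..T} r *\<^sub>R \<gamma> r \<partial>horizon T)" if "s \<in> {0..T}" for s
      using E' that by auto
    have eb: "\<theta> * (\<alpha> * x s - L * n s) - \<eta> * (x s + n s) - k / \<eta> \<le> e s"
      if "s \<in> {0..T}" "0 \<le> \<theta>" "\<theta> \<le> 1" for s \<theta>
      using E' that \<eta> by auto
    have A: "0 \<le> A" "0 \<le> x0" using E' by auto
    have D: "a0 / 2 * A - k - \<eta> * x T - k / \<eta> \<le> D" using E' \<eta> by auto
    have De: "D + (\<integral>t. e t \<partial>horizon T) \<le> \<eta> * (2 * A + 2 * T * (\<integral>t. \<gamma> t \<partial>horizon T)) + x0 / \<eta>"
      using E' \<eta> by auto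
    define \<theta> where "\<theta> = (\<lambda>s. \<theta>0 * exp (K * (s - T)))"
    define S where "S = (\<integral>s. x s + n s \<partial>horizon T)"
    define N where "N = (\<integral>s. \<theta> s * n s \<partial>horizon T)"
    define \<Xi> where "\<Xi> = (\<integral>s. \<theta> s * x s \<partial>horizon T)"
    define \<Theta> where "\<Theta> = (\<integral>s. \<theta> s \<partial>horizon T)"
    have \<theta>b: "\<theta>m \<le> \<theta> s" "\<theta> s \<le> \<theta>0" if "s \<in> {0..T}" for s
    proof -
      have "- K * T \<le> K * (s - T)" "K * (s - T) \<le> 0"
        using that K(1) by (auto simp: algebra_simps mult_le_0_iff)
      then show "\<theta>m \<le> \<theta> s" "\<theta> s \<le> \<theta>0" using \<theta>0(1) by (simp_all add: \<theta>_def \<theta>m_def)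
    qed
    have [measurable]: "\<theta> \<in> borel_measurable (horizon T)" unfolding \<theta>_def by measurable
    have i: "integrable (horizon T) (\<lambda>t. \<theta> t * h t)" if "integrable (horizon T) h" for h
    proof (rule Bochner_Integration.integrable_bound)
      show "integrable (horizon T) (\<lambda>t. \<theta>0 * h t)" using that by simp
      show "(\<lambda>t. \<theta> t * h t) \<in> borel_measurable (horizon T)"
        using borel_measurable_integrable[OF that] by measurable
      show "AE t in horizon T. norm (\<theta> t * h t) \<le> norm (\<theta>0 * h t)"
      proof (rule AE_I2)
        fix s assume "s \<in> space (horizon T)"
        then have "0 \<le> \<theta> s" "\<theta> s \<le> \<theta>0" using \<theta>b[of s] \<theta>m by (auto simp: space_restrict_space)
        then show "norm (\<theta> s * h s) \<le> norm (\<theta>0 * h s)" by (simp add: abs_mult mult_right_mono)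
      qed
    qed
    have i\<theta>: "integrable (horizon T) \<theta>" using i[of "\<lambda>_. 1"] by simp
    have \<Theta>: "0 \<le> \<Theta>" "\<Theta> \<le> \<theta>0 * T" "\<Theta> \<le> T"
    proof -
      show "0 \<le> \<Theta>" unfolding \<Theta>_def
        using \<theta>b \<theta>m by (intro Bochner_Integration.integral_nonneg) (force simp: space_restrict_space)
      have "\<Theta> \<le> (\<integral>s. \<theta>0 \<partial>horizon T)" unfolding \<Theta>_def
        using \<theta>b by (intro integral_mono i\<theta>) (auto simp: space_restrict_space)
      also have "\<dots> = \<theta>0 * T" using T by (subst integral_const_horizon) auto
      finally show "\<Theta> \<le> \<theta>0 * T" .
      also have "\<dots> \<le> T" using \<theta>0 T by simp
      finally show "\<Theta> \<le> T" .
    qed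
    have nonneg: "0 \<le> \<Xi>" "0 \<le> N"
      unfolding \<Xi>_def N_def using \<theta>b(1) nn \<theta>m
      by (auto intro!: Bochner_Integration.integral_nonneg mult_nonneg_nonneg simp: space_restrict_space
        intro: order_trans[OF less_imp_le])
    have Nle: "N \<le> 4 * A * \<Theta> + 4 * T * k / K * (\<Theta> + \<Xi>)"
      unfolding N_def \<Theta>_def \<Xi>_def \<theta>_def
      by (rule weighted_Gronwall[OF T k K(1,2) _ A(1) int(2,1,4) nn(4,2) gr(2) nb]) (use \<theta>0 in auto)
    have N1: "N \<le> 4 * T * A + T + \<Xi>"
    proof -
      have "4 * A * \<Theta> \<le> 4 * A * T" using A \<Theta> by (intro mult_left_mono) auto
      moreover have "4 * T * k / K * (\<Theta> + \<Xi>) \<le> 1 * (\<Theta> + \<Xi>)"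
        using K(3) \<Theta> nonneg by (intro mult_right_mono) auto
      ultimately show ?thesis using Nle \<Theta>(3) by (simp add: mult_ac)
    qed
    have LN: "L * N \<le> a0 / 4 * A + \<alpha> / 2 * (T + \<Xi>)"
    proof -
      have "L * N \<le> L * (4 * A * \<Theta> + 4 * T * k / K * (\<Theta> + \<Xi>))" using Nle L by (rule mult_left_mono)
      also have "\<dots> = 4 * L * A * \<Theta> + L * (4 * T * k / K) * (\<Theta> + \<Xi>)" by (simp add: algebra_simps)
      also have "\<dots> \<le> 4 * L * A * (\<theta>0 * T) + \<alpha> / 2 * (T + \<Xi>)"
        using K(4) \<Theta> nonneg A L \<alpha> by (intro add_mono mult_left_mono mult_mono) auto
      also have "4 * L * A * (\<theta>0 * T) = A * (4 * L * T * \<theta>0)" by simp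
      also have "\<dots> \<le> A * (a0 / 4)" using \<theta>0(3) A(1) by (rule mult_left_mono)
      finally show ?thesis by (simp add: mult_ac)
    qed
    have Sle: "S \<le> (\<Xi> + N) / \<theta>m"
    proof -
      have "\<theta>m * S = (\<integral>s. \<theta>m * (x s + n s) \<partial>horizon T)" by (simp add: S_def)
      also have "\<dots> \<le> (\<integral>s. \<theta> s * x s + \<theta> s * n s \<partial>horizon T)"
      proof (rule integral_mono)
        fix s assume "s \<in> space (horizon T)"
        then have s: "s \<in> {0..T}" by (simp add: space_restrict_space)
        show "\<theta>m * (x s + n s) \<le> \<theta> s * x s + \<theta> s * n s"
          unfolding distrib_left[symmetric] using nn[OF s] \<theta>b[OF s] by (intro mult_right_mono) auto
      qed (use int i[OF int(1)] i[OF int(2)] in auto)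
      also have "\<dots> = \<Xi> + N" using i[OF int(1)] i[OF int(2)] by (simp add: \<Xi>_def N_def)
      finally show ?thesis using \<theta>m by (simp add: pos_le_divide_eq mult.commute)
    qed
    have S1: "S \<le> (2 * \<Xi> + 4 * T * A + T) / \<theta>m"
      using N1 \<theta>m by (intro order_trans[OF Sle] divide_right_mono) auto
    have S0: "0 \<le> S" unfolding S_def
      using nn by (intro Bochner_Integration.integral_nonneg) (auto simp: space_restrict_space)
    have drift: "(\<integral>r. indicator I r *\<^sub>R h r \<partial>horizon T) \<le> k * (T + S)"
      if h: "integrable (horizon T) h" "\<And>s. s \<in> {0..T} \<Longrightarrow> 0 \<le> h s \<and> h s \<le> k * (1 + x s + n s)"
      and I: "I \<in> sets borel" for h and I :: "real set"
    proof -
      have [measurable]: "h \<in> borel_measurable (horizon T)" "I \<in> sets borel" using h I by auto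
      have "(\<integral>r. indicator I r *\<^sub>R h r \<partial>horizon T) \<le> (\<integral>r. k * (1 + (x r + n r)) \<partial>horizon T)"
      proof (rule integral_mono)
        show "integrable (horizon T) (\<lambda>r. indicator I r *\<^sub>R h r)"
          by (rule Bochner_Integration.integrable_bound[OF h(1)]) (measurable, auto split: split_indicator)
        fix s assume "s \<in> space (horizon T)"
        then have s: "s \<in> {0..T}" by (simp add: space_restrict_space)
        show "indicator I s *\<^sub>R h s \<le> k * (1 + (x s + n s))"
          using h(2)[OF s] by (auto split: split_indicator simp: add.assoc)
      qed (use int in auto)
      also have "\<dots> = k * (T + S)" using int T by (simp add: S_def space_restrict_space measure_horizon)
      finally show ?thesis .
    qed
    have \<gamma>I: "(\<integral>r. indicator I r *\<^sub>R \<gamma> r \<partial>horizon T) \<le> k * (T + S)" if "I \<in> sets borel" for I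
      by (rule drift[OF int(4) _ that]) (use nn gr in auto)
    have \<phi>I: "(\<integral>r. indicator I r *\<^sub>R \<phi> r \<partial>horizon T) \<le> k * (T + S)" if "I \<in> sets borel" for I
      by (rule drift[OF int(3) _ that]) (use nn gr in auto)
    have \<gamma>I': "(\<integral>r. \<gamma> r \<partial>horizon T) \<le> k * (T + S)" using \<gamma>I[of UNIV] by simp
    have xT: "x T \<le> 2 * x0 + 2 * T * (k * (T + S))"
      using xb[of T] \<phi>I[of "{0..T}"] T by (auto intro: order_trans add_left_mono mult_left_mono)
    have eI: "\<alpha> * \<Xi> - L * N - \<eta> * S - T * k / \<eta> \<le> (\<integral>t. e t \<partial>horizon T)"
    proof -
      have "\<alpha> * \<Xi> - L * N - \<eta> * S - T * k / \<eta>
          = (\<integral>s. \<alpha> * (\<theta> s * x s) - L * (\<theta> s * n s) - \<eta> * (x s + n s) - k / \<eta> \<partial>horizon T)"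
        using i[OF int(1)] i[OF int(2)] int T
        by (simp add: \<Xi>_def N_def S_def space_restrict_space measure_horizon)
      also have "\<dots> \<le> (\<integral>t. e t \<partial>horizon T)"
      proof (rule integral_mono)
        fix s assume "s \<in> space (horizon T)"
        then have s: "s \<in> {0..T}" by (simp add: space_restrict_space)
        show "\<alpha> * (\<theta> s * x s) - L * (\<theta> s * n s) - \<eta> * (x s + n s) - k / \<eta> \<le> e s"
          using eb[OF s, of "\<theta> s"] \<theta>b[OF s] \<theta>m \<theta>0 by (simp add: algebra_simps)
      qed (use i[OF int(1)] i[OF int(2)] int in auto)
      finally show ?thesis .
    qed
    have fin: "a0 / 8 * A + \<alpha> / 4 * \<Xi> \<le> c3 + c4 * x0"
    proof -
      let ?Q = "2 * x0 + 2 * T * (k * (T + S)) + S + (2 * A + 2 * T * (k * (T + S)))"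
      have "\<eta> * x T \<le> \<eta> * (2 * x0 + 2 * T * (k * (T + S)))" using xT \<eta>(1) by simp
      moreover have "\<eta> * (2 * A + 2 * T * (\<integral>t. \<gamma> t \<partial>horizon T)) \<le> \<eta> * (2 * A + 2 * T * (k * (T + S)))"
        using \<gamma>I' \<eta>(1) T by simp
      moreover have "\<eta> * ?Q = \<eta> * (2 * x0 + 2 * T * (k * (T + S))) + \<eta> * S
          + \<eta> * (2 * A + 2 * T * (k * (T + S)))"
        by (simp only: distrib_left)
      ultimately have 1: "a0 / 2 * A + \<alpha> * \<Xi> - L * N
          \<le> k + k / \<eta> + T * k / \<eta> + x0 / \<eta> + \<eta> * ?Q"
        using D De eI by linarith
      have "?Q = 2 * x0 + 4 * T\<^sup>2 * k + 2 * A + (4 * T * k + 1) * S"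
        by (simp add: algebra_simps power2_eq_square)
      also have "\<dots> \<le> 2 * x0 + 4 * T\<^sup>2 * k + 2 * A + (4 * T * k + 1) * ((2 * \<Xi> + 4 * T * A + T) / \<theta>m)"
        using S1 Tk by (intro add_left_mono mult_left_mono) auto
      also have "\<dots> = 2 * x0 + c0 + c1 * A + c2 * \<Xi>"
        by (simp add: c0_def c1_def c2_def algebra_simps add_divide_distrib)
      finally have "\<eta> * ?Q \<le> \<eta> * (2 * x0 + c0 + c1 * A + c2 * \<Xi>)" using \<eta>(1) by simp
      also have "\<dots> = 2 * \<eta> * x0 + \<eta> * c0 + \<eta> * c1 * A + \<eta> * c2 * \<Xi>" by (simp add: algebra_simps)
      also have "\<dots> \<le> 2 * \<eta> * x0 + \<eta> * c0 + a0 / 8 * A + \<alpha> / 4 * \<Xi>"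
        using \<eta> c A nonneg by (intro add_mono mult_right_mono) auto
      finally have 2: "\<eta> * ?Q \<le> 2 * \<eta> * x0 + \<eta> * c0 + a0 / 8 * A + \<alpha> / 4 * \<Xi>" .
      have "c3 + c4 * x0 = k + \<alpha> / 2 * T + k / \<eta> + T * k / \<eta> + \<eta> * c0 + x0 / \<eta> + 2 * \<eta> * x0"
        by (simp add: c3_def c4_def add_divide_distrib algebra_simps)
      with 1 2 LN[unfolded distrib_left] show ?thesis by linarith
    qed
    have c34': "c3 + c4 * x0 \<le> (c3 + c4) * (1 + x0)"
      using c34 A by (simp add: algebra_simps)
    have Ale: "A \<le> cA * (1 + x0)"
    proof -
      have "0 \<le> \<alpha> / 4 * \<Xi>" using \<alpha> nonneg by simp
      then have "a0 / 8 * A \<le> (c3 + c4) * (1 + x0)" using fin c34' by linarith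
      then have "8 / a0 * (a0 / 8 * A) \<le> 8 / a0 * ((c3 + c4) * (1 + x0))"
        using a0 by (intro mult_left_mono) auto
      moreover have "8 / a0 * (a0 / 8 * A) = A" using a0 by simp
      ultimately show ?thesis by (simp only: cA_def mult.assoc)
    qed
    have Xle: "\<Xi> \<le> cX * (1 + x0)"
    proof -
      have "0 \<le> a0 / 8 * A" using a0 A by simp
      then have "\<alpha> / 4 * \<Xi> \<le> (c3 + c4) * (1 + x0)" using fin c34' by linarith
      then have "4 / \<alpha> * (\<alpha> / 4 * \<Xi>) \<le> 4 / \<alpha> * ((c3 + c4) * (1 + x0))"
        using \<alpha> by (intro mult_left_mono) auto
      moreover have "4 / \<alpha> * (\<alpha> / 4 * \<Xi>) = \<Xi>" using \<alpha> by simp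
      ultimately show ?thesis by (simp only: cX_def mult.assoc)
    qed
    have x01: "1 \<le> 1 + x0" using A by simp
    have Sb: "S \<le> cS * (1 + x0)"
    proof -
      have "2 * \<Xi> + 4 * T * A + T \<le> 2 * (cX * (1 + x0)) + 4 * T * (cA * (1 + x0)) + T * (1 + x0)"
        using Xle Ale T A by (intro add_mono mult_left_mono) auto
      also have "\<dots> = (2 * cX + 4 * T * cA + T) * (1 + x0)" by (simp add: algebra_simps)
      finally have "(2 * \<Xi> + 4 * T * A + T) / \<theta>m \<le> (2 * cX + 4 * T * cA + T) * (1 + x0) / \<theta>m"
        using \<theta>m by (intro divide_right_mono) auto
      then show ?thesis using S1 by (simp add: cS_def)
    qed
    have dr: "2 * T * (k * (T + S)) \<le> 2 * T * k * (T + cS) * (1 + x0)"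
    proof -
      have "0 \<le> T * x0" using T A by simp
      moreover have "(T + cS) * (1 + x0) = T + T * x0 + cS * (1 + x0)" by (simp add: algebra_simps)
      ultimately have "T + S \<le> (T + cS) * (1 + x0)" using Sb by linarith
      then have "2 * T * k * (T + S) \<le> 2 * T * k * ((T + cS) * (1 + x0))"
        using Tk by (intro mult_left_mono) auto
      then show ?thesis by (simp add: mult_ac)
    qed
    define P where "P = 2 * T * (k * (T + S))"
    define Q where "Q = 2 * T * k * (T + cS) * (1 + x0)"
    define Y where "Y = cA * (1 + x0)"
    have xP: "x t \<le> 2 * x0 + P"
      using xb[OF t] \<phi>I[of "{0..t}"] T unfolding P_def
      by (auto intro: order_trans add_left_mono mult_left_mono)
    have nP: "n t \<le> 2 * A + P"
      using nb[OF t] \<gamma>I[of "{t..T}"] T unfolding P_def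
      by (auto intro: order_trans add_left_mono mult_left_mono)
    have Z: "C * (1 + x0) = 2 * (1 + x0) + 2 * Y + Q"
      by (simp add: C_def P_def Q_def Y_def algebra_simps)
    have Y: "0 \<le> Y" using cAX A by (simp add: Y_def)
    have PQ: "P \<le> Q" and AY: "A \<le> Y" using dr Ale by (simp_all only: P_def Q_def Y_def)
    show ?thesis
      unfolding Z using xP nP Y PQ AY A by auto
  qed
  then show ?thesis using C0 by blast
qed

section \<open>Solutions of the monotone system\<close>

text \<open>This lets $\tilde W_0$ be treated as a lift with a dummy control argument.\<close>

lemma W2_continuous_ignore:
  assumes "W2_continuous f"
  shows "W2_continuous (\<lambda>(x, u :: 'u::metric_space) \<mu>. f x \<mu>)"
  unfolding W2_continuous_def
proof (intro allI ballI impI)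
  fix p :: "'a \<times> 'u" and \<mu> :: "'b measure" and \<epsilon> :: real
  assume "\<mu> \<in> P2" "\<epsilon> > 0"
  then obtain \<delta> where "\<delta> > 0"
    and d: "\<And>y \<nu>. \<nu> \<in> P2 \<Longrightarrow> dist y (fst p) < \<delta> \<Longrightarrow> W2 \<nu> \<mu> < \<delta> \<Longrightarrow> dist (f y \<nu>) (f (fst p) \<mu>) < \<epsilon>"
    using assms unfolding W2_continuous_def by metis
  moreover have "dist a (fst p) < \<delta>" if "dist (a, u) p < \<delta>" for a :: 'a and u :: 'u
    using dist_fst_le[of "(a, u)" p] that by simp
  ultimately show "\<exists>\<delta>>0. \<forall>q. \<forall>\<nu>\<in>P2. dist q p < \<delta> \<and> W2 \<nu> \<mu> < \<delta> \<longrightarrow>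
      dist ((\<lambda>(x, u) \<mu>. f x \<mu>) q \<nu>) ((\<lambda>(x, u) \<mu>. f x \<mu>) p \<mu>) < \<epsilon>"
    by (intro exI[of _ \<delta>]) (auto simp: case_prod_beta)
qed

locale monotone_system = brownian_motion M Fil T B
  for M :: "'w measure" and Fil :: "real \<Rightarrow> 'w measure" and T :: real
    and B :: "real \<Rightarrow> 'w \<Rightarrow> real ^ 'n" +
  fixes \<sigma> \<alpha> L a0 c :: real
    and W0 :: "real ^ 'n \<Rightarrow> (real ^ 'n) measure \<Rightarrow> real ^ 'n"
    and F G :: "real ^ 'n \<Rightarrow> (real ^ 'n) measure \<Rightarrow> real ^ 'n \<Rightarrow> real ^ 'n"
    and X0 :: "'w \<Rightarrow> real ^ 'n" and X W :: "real \<Rightarrow> 'w \<Rightarrow> real ^ 'n"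
    and Z :: "real \<Rightarrow> 'w \<Rightarrow> real ^ 'n ^ 'n"
  assumes T_pos: "0 < T" and a0_pos: "0 < a0"
    and cont: "W2_continuous W0" "W2_continuous (\<lambda>(x, u) \<mu>. F x \<mu> u)"
      "W2_continuous (\<lambda>(x, u) \<mu>. G x \<mu> u)"
    and growth: "\<mu> \<in> P2 \<Longrightarrow> norm (W0 x \<mu>) + norm (F x \<mu> u) + norm (G x \<mu> u)
        \<le> c * (1 + norm x + norm u + sqrt (E2 \<mu>))"
    and mono_W0: "P \<in> L2 M \<Longrightarrow> Q \<in> L2 M \<Longrightarrow>
        L2inner M (\<lambda>w. lift1 M W0 P w - lift1 M W0 Q w) (\<lambda>w. P w - Q w)
          \<ge> a0 * (L2norm M (\<lambda>w. lift1 M W0 P w - lift1 M W0 Q w))\<^sup>2"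
    and mono: "P \<in> L2 M \<Longrightarrow> Q \<in> L2 M \<Longrightarrow> U \<in> L2 M \<Longrightarrow> V \<in> L2 M \<Longrightarrow>
        L2inner M (\<lambda>w. lift2 M G P U w - lift2 M G Q V w) (\<lambda>w. P w - Q w)
          + L2inner M (\<lambda>w. lift2 M F P U w - lift2 M F Q V w) (\<lambda>w. U w - V w) \<ge> 0"
    and strong_mono: "P \<in> L2 M \<Longrightarrow> Q \<in> L2 M \<Longrightarrow> U \<in> L2 M \<Longrightarrow> V \<in> L2 M \<Longrightarrow>
        L2inner M (\<lambda>w. lift2 M G P U w - lift2 M G Q V w) (\<lambda>w. P w - Q w)
          + L2inner M (\<lambda>w. lift2 M F P U w - lift2 M F Q V w) (\<lambda>w. U w - V w)
          \<ge> \<alpha> * (L2norm M (\<lambda>w. P w - Q w))\<^sup>2 - L * (L2norm M (\<lambda>w. U w - V w))\<^sup>2"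
    and X0: "X0 \<in> L2 M"
    and sol: "strong_solution M Fil B T \<sigma> W0 F G X0 X W Z"
begin

definition "f s = lift2 M F (X s) (W s)"
definition "g s = lift2 M G (X s) (W s)"
definition "\<omega> = lift1 M W0 (X T)"
definition "X' t w = X0 w - (\<integral>s. indicator {0..t} s *\<^sub>R f s w \<partial>horizon T)"
definition "V t w = \<omega> w + (\<integral>s. indicator {t..T} s *\<^sub>R g s w \<partial>horizon T)"
text \<open>A bound on $\|\sigma B_t\|^2$ for $t \le T$, and the growth constant that results from it when
  $X$ is replaced by $X'$.\<close>

definition "noise_sq = \<sigma>\<^sup>2 * (real CARD('n) * T)"
definition "growth_sq = 16 * c\<^sup>2 * (1 + noise_sq)"

lemma noise_sq_nonneg: "0 \<le> noise_sq" and growth_sq_nonneg: "0 \<le> growth_sq"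
  using T_pos by (simp_all add: noise_sq_def growth_sq_def)

lemma XW_L2: "t \<in> {0..T} \<Longrightarrow> X t \<in> L2 M" "t \<in> {0..T} \<Longrightarrow> W t \<in> L2 M"
    "case_prod X \<in> L2 (time_prod {0..T} M)" "case_prod W \<in> L2 (time_prod {0..T} M)"
  and XW_adapted: "t \<in> {0..T} \<Longrightarrow> X t \<in> borel_measurable (Fil t)"
    "t \<in> {0..T} \<Longrightarrow> W t \<in> borel_measurable (Fil t)"
  using sol unfolding strong_solution_def by auto

lemma growth_F: "\<mu> \<in> P2 \<Longrightarrow> norm (F x \<mu> u) \<le> c * (1 + norm x + norm u + sqrt (E2 \<mu>))"
  and growth_G: "\<mu> \<in> P2 \<Longrightarrow> norm (G x \<mu> u) \<le> c * (1 + norm x + norm u + sqrt (E2 \<mu>))"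
  and growth_W0: "\<mu> \<in> P2 \<Longrightarrow> norm (W0 x \<mu>) \<le> c * (1 + norm x + norm u + sqrt (E2 \<mu>))"
  using growth[of \<mu> x u] norm_ge_zero[of "F x \<mu> u"] norm_ge_zero[of "G x \<mu> u"]
    norm_ge_zero[of "W0 x \<mu>"] by linarith+

lemmas L2_F = L2_lift2[OF cont(2) growth_F]
lemmas L2_G = L2_lift2[OF cont(3) growth_G]

lemma L2_W0:
  assumes "P \<in> L2 M"
  shows "lift1 M W0 P \<in> L2 M" and "(L2norm M (lift1 M W0 P))\<^sup>2 \<le> 8 * c\<^sup>2 * (1 + (L2norm M P)\<^sup>2)"
proof -
  have z: "(\<lambda>_. 0) \<in> L2 M" "L2norm M (\<lambda>_. 0 :: real ^ 'n) = 0" by (simp_all add: L2_def L2norm_def)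
  have eq: "lift1 M W0 P = lift2 M (\<lambda>x \<mu> (u :: real ^ 'n). W0 x \<mu>) P (\<lambda>_. 0)"
    by (simp add: lift1_def lift2_def)
  show "lift1 M W0 P \<in> L2 M" "(L2norm M (lift1 M W0 P))\<^sup>2 \<le> 8 * c\<^sup>2 * (1 + (L2norm M P)\<^sup>2)"
    using L2_lift2[OF W2_continuous_ignore[OF cont(1)] growth_W0 assms z(1)] z(2)
    unfolding eq by auto
qed

lemma \<omega>_L2: "\<omega> \<in> L2 M"
  unfolding \<omega>_def using T_pos by (intro L2_W0 XW_L2) simp

lemma drift_L2:
  assumes "t \<in> {0..T}"
  shows "f t \<in> L2 M" "g t \<in> L2 M"
    and "(L2norm M (f t))\<^sup>2 \<le> 8 * c\<^sup>2 * (1 + (L2norm M (X t))\<^sup>2 + (L2norm M (W t))\<^sup>2)"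
    and "(L2norm M (g t))\<^sup>2 \<le> 8 * c\<^sup>2 * (1 + (L2norm M (X t))\<^sup>2 + (L2norm M (W t))\<^sup>2)"
  unfolding f_def g_def using assms by (auto intro!: L2_F L2_G XW_L2)

lemma drift_process_L2:
  "case_prod f \<in> L2 (time_prod {0..T} M)" "case_prod g \<in> L2 (time_prod {0..T} M)"
proof -
  let ?h = "\<lambda>t. 8 * c\<^sup>2 * (1 + (L2norm M (X t))\<^sup>2 + (L2norm M (W t))\<^sup>2)"
  have h: "integrable (horizon T) ?h"
    using process_norm(1)[OF XW_L2(3)] process_norm(1)[OF XW_L2(4)]
    by (intro integrable_mult_right Bochner_Integration.integrable_add) auto
  have "integrable (time_prod {0..T} M) (case_prod f)" "integrable (time_prod {0..T} M) (case_prod g)"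
    using sol unfolding strong_solution_def f_def g_def by simp_all
  then show "case_prod f \<in> L2 (time_prod {0..T} M)" "case_prod g \<in> L2 (time_prod {0..T} M)"
    using drift_L2 by (auto intro!: process_L2I[OF _ _ _ h])
qed

lemma f_adapted: "t \<in> {0..T} \<Longrightarrow> f t \<in> borel_measurable (Fil t)"
  unfolding f_def
  by (rule borel_measurable_lift2[OF cont(2) law_in_P2(1)[OF XW_L2(1)] XW_adapted])

lemma X'_V_L2:
  assumes "t \<in> {0..T}"
  shows "X' t \<in> L2 M" "V t \<in> L2 M"
  using assms time_integral_L2(1)[OF drift_process_L2(1) measure_horizon(2)]
    time_integral_L2(1)[OF drift_process_L2(2) measure_horizon(2)]
  unfolding X'_def[abs_def] V_def[abs_def] by (auto intro!: L2_add L2_diff X0 \<omega>_L2)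

lemma X_eq:
  assumes "t \<in> {0..T}"
  shows "AE w in M. X t w = X' t w + \<sigma> *\<^sub>R B t w"
proof -
  have "AE w in M. X t w = X0 w - (LINT s:{0..t}|lborel. f s w) + \<sigma> *\<^sub>R B t w"
    using sol assms unfolding strong_solution_def f_def by auto
  then show ?thesis
    using assms by (simp add: set_integral_horizon[of 0 t T] X'_def)
qed

lemma reference_L2:
  assumes "t \<in> {0..T}"
  shows "(\<lambda>w. \<sigma> *\<^sub>R B t w) \<in> L2 M" and "(L2norm M (\<lambda>w. \<sigma> *\<^sub>R B t w))\<^sup>2 \<le> noise_sq"
proof -
  show "(\<lambda>w. \<sigma> *\<^sub>R B t w) \<in> L2 M" using B_L2(1)[OF assms] by (rule L2_scaleR)
  have "(L2norm M (\<lambda>w. \<sigma> *\<^sub>R B t w))\<^sup>2 = \<sigma>\<^sup>2 * (real CARD('n) * t)"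
    using B_L2(2)[OF assms] by (simp add: L2norm_scaleR power_mult_distrib)
  also have "\<dots> \<le> noise_sq" unfolding noise_sq_def using assms by (intro mult_left_mono) auto
  finally show "(L2norm M (\<lambda>w. \<sigma> *\<^sub>R B t w))\<^sup>2 \<le> noise_sq" .
qed

lemma norm_X_le:
  assumes "t \<in> {0..T}"
  shows "(L2norm M (X t))\<^sup>2 \<le> 2 * (L2norm M (X' t))\<^sup>2 + 2 * noise_sq"
proof -
  note r = reference_L2[OF assms] and x = X'_V_L2(1)[OF assms]
  have "L2norm M (X t) = L2norm M (\<lambda>w. X' t w + \<sigma> *\<^sub>R B t w)"
    using L2_measurable[OF XW_L2(1)[OF assms]] L2_measurable[OF L2_add(1)[OF x r(1)]]
    by (intro L2norm_cong_AE X_eq assms)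
  then show ?thesis using L2_add(2)[OF x r(1)] r(2) by simp
qed

lemma drift_growth:
  assumes "t \<in> {0..T}"
  shows "(L2norm M (f t))\<^sup>2 \<le> growth_sq * (1 + (L2norm M (X' t))\<^sup>2 + (L2norm M (W t))\<^sup>2)"
    and "(L2norm M (g t))\<^sup>2 \<le> growth_sq * (1 + (L2norm M (X' t))\<^sup>2 + (L2norm M (W t))\<^sup>2)"
proof -
  let ?x = "(L2norm M (X' t))\<^sup>2" and ?n = "(L2norm M (W t))\<^sup>2"
  have "1 + (L2norm M (X t))\<^sup>2 + ?n \<le> 1 + (2 * ?x + 2 * noise_sq) + ?n"
    using norm_X_le[OF assms] by simp
  also have "\<dots> \<le> 2 * ((1 + noise_sq) * (1 + ?x + ?n))"
    using noise_sq_nonneg mult_nonneg_nonneg[OF noise_sq_nonneg, of ?x] mult_nonneg_nonneg[OF noise_sq_nonneg, of ?n]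
    by (simp add: algebra_simps)
  finally have "8 * c\<^sup>2 * (1 + (L2norm M (X t))\<^sup>2 + ?n) \<le> 8 * c\<^sup>2 * (2 * ((1 + noise_sq) * (1 + ?x + ?n)))"
    by (intro mult_left_mono) auto
  also have "\<dots> = growth_sq * (1 + ?x + ?n)" by (simp add: growth_sq_def)
  finally show "(L2norm M (f t))\<^sup>2 \<le> growth_sq * (1 + ?x + ?n)" "(L2norm M (g t))\<^sup>2 \<le> growth_sq * (1 + ?x + ?n)"
    using drift_L2(3,4)[OF assms] by linarith+
qed

text \<open>$V_t - W_t$ is an It\^o integral over $[t, T]$.\<close>

lemma W_inner:
  assumes t: "t \<in> {0..T}" and Y: "Y \<in> borel_measurable (Fil t)" "Y \<in> L2 M"
  shows "L2inner M (W t) Y = L2inner M (V t) Y"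
proof -
  obtain I where I: "has_ito_integral M Fil B t T Z I"
    and eq: "AE w in M. W t w = lift1 M W0 (X T) w + (LINT s:{t..T}|lborel. g s w) - I w"
    using sol t unfolding strong_solution_def g_def by meson
  have eq': "AE w in M. W t w = V t w - I w"
    using eq t by (simp add: V_def \<omega>_def set_integral_horizon[of t T T])
  have IL: "I \<in> L2 M" using I by (simp add: has_ito_integral_def)
  note VL = X'_V_L2(2)[OF t] and WL = XW_L2(2)[OF t]
  have "L2inner M (W t) Y = L2inner M (\<lambda>w. V t w - I w) Y"
    unfolding L2inner_def
    using eq' L2_integrable_inner[OF WL Y(2)] L2_integrable_inner[OF L2_diff(1)[OF VL IL] Y(2)]
    by (intro integral_cong_AE) (auto dest: borel_measurable_integrable)
  also have "\<dots> = L2inner M (V t) Y - L2inner M I Y" by (rule L2inner_diff_left[OF VL IL Y(2)])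
  also have "L2inner M I Y = 0" using t by (intro L2_ito_orthogonal[OF _ I Y]) simp
  finally show ?thesis by simp
qed

lemma norm_V_le:
  assumes t: "t \<in> {0..T}"
  shows "(L2norm M (V t))\<^sup>2 \<le> 2 * (L2norm M \<omega>)\<^sup>2
    + 2 * T * (\<integral>s. indicator {t..T} s *\<^sub>R (L2norm M (g s))\<^sup>2 \<partial>horizon T)"
proof -
  have S: "{t..T} \<in> sets (horizon T)" "measure (horizon T) {t..T} \<le> T"
    using t by (auto simp: measure_horizon)
  note J = time_integral_L2[OF drift_process_L2(2) S(1)]
  have nn: "0 \<le> (\<integral>s. indicator {t..T} s * (L2norm M (g s))\<^sup>2 \<partial>horizon T)"
    by (intro Bochner_Integration.integral_nonneg) auto
  have "(L2norm M (V t))\<^sup>2 \<le> 2 * (L2norm M \<omega>)\<^sup>2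
      + 2 * (L2norm M (\<lambda>w. \<integral>s. indicator {t..T} s *\<^sub>R g s w \<partial>horizon T))\<^sup>2"
    unfolding V_def[abs_def] by (rule L2_add(2)[OF \<omega>_L2 J(1)])
  then show ?thesis using J(2) mult_right_mono[OF S(2) nn] by simp
qed

lemma norm_X'_le:
  assumes t: "t \<in> {0..T}"
  shows "(L2norm M (X' t))\<^sup>2 \<le> 2 * (L2norm M X0)\<^sup>2
    + 2 * T * (\<integral>s. indicator {0..t} s *\<^sub>R (L2norm M (f s))\<^sup>2 \<partial>horizon T)"
proof -
  have S: "{0..t} \<in> sets (horizon T)" "measure (horizon T) {0..t} \<le> T"
    using t by (auto simp: measure_horizon)
  note J = time_integral_L2[OF drift_process_L2(1) S(1)]
  have nn: "0 \<le> (\<integral>s. indicator {0..t} s * (L2norm M (f s))\<^sup>2 \<partial>horizon T)"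
    by (intro Bochner_Integration.integral_nonneg) auto
  have "(L2norm M (X' t))\<^sup>2 \<le> 2 * (L2norm M X0)\<^sup>2
      + 2 * (L2norm M (\<lambda>w. \<integral>s. indicator {0..t} s *\<^sub>R f s w \<partial>horizon T))\<^sup>2"
    unfolding X'_def[abs_def] by (rule L2_diff(2)[OF X0 J(1)])
  then show ?thesis using J(2) mult_right_mono[OF S(2) nn] by simp
qed

text \<open>$W_t$ is the projection of $V_t$ onto the $\mathcal F_t$-measurable variables.\<close>

lemma norm_W_le_norm_V:
  assumes t: "t \<in> {0..T}"
  shows "(L2norm M (W t))\<^sup>2 \<le> (L2norm M (V t))\<^sup>2"
proof -
  have "(L2norm M (W t))\<^sup>2 = L2inner M (W t) (W t)"
    by (simp add: L2inner_def L2norm_power2 power2_norm_eq_inner)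
  also have "\<dots> = L2inner M (V t) (W t)"
    by (rule W_inner[OF t XW_adapted(2)[OF t] XW_L2(2)[OF t]])
  also have "\<dots> \<le> 1 / 2 * (L2norm M (V t))\<^sup>2 + (L2norm M (W t))\<^sup>2 / (4 * (1 / 2))"
    using L2inner_Young[OF X'_V_L2(2)[OF t] XW_L2(2)[OF t], of "1 / 2"] by simp
  finally show ?thesis by linarith
qed

lemma L2inner_cong_right:
  assumes "AE w in M. Y w = Y' w" "P \<in> L2 M" "Y \<in> L2 M" "Y' \<in> L2 M"
  shows "L2inner M P Y = L2inner M P Y'"
  unfolding L2inner_def
  using assms L2_integrable_inner[OF assms(2,3)] L2_integrable_inner[OF assms(2,4)]
  by (intro integral_cong_AE) (auto dest: borel_measurable_integrable)

lemma zero_L2: "(\<lambda>_. 0) \<in> L2 M" "L2norm M (\<lambda>_. 0 :: real ^ 'n) = 0"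
  by (simp_all add: L2_def L2norm_def)

lemma reference_coefficients:
  assumes t: "t \<in> {0..T}"
  defines "R \<equiv> \<lambda>w. \<sigma> *\<^sub>R B t w"
  shows "lift2 M F R (\<lambda>_. 0) \<in> L2 M" "(L2norm M (lift2 M F R (\<lambda>_. 0)))\<^sup>2 \<le> growth_sq"
    and "lift2 M G R (\<lambda>_. 0) \<in> L2 M" "(L2norm M (lift2 M G R (\<lambda>_. 0)))\<^sup>2 \<le> growth_sq"
    and "lift1 M W0 R \<in> L2 M" "(L2norm M (lift1 M W0 R))\<^sup>2 \<le> growth_sq"
proof -
  have R: "R \<in> L2 M" "(L2norm M R)\<^sup>2 \<le> noise_sq" unfolding R_def by (rule reference_L2[OF t])+
  have "8 * c\<^sup>2 * (1 + (L2norm M R)\<^sup>2) \<le> 8 * c\<^sup>2 * (2 * (1 + noise_sq))"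
    using R(2) noise_sq_nonneg by (intro mult_left_mono) auto
  also have "\<dots> = growth_sq" by (simp add: growth_sq_def)
  finally have k: "8 * c\<^sup>2 * (1 + (L2norm M R)\<^sup>2) \<le> growth_sq" .
  show "lift2 M F R (\<lambda>_. 0) \<in> L2 M" "lift2 M G R (\<lambda>_. 0) \<in> L2 M" "lift1 M W0 R \<in> L2 M"
    by (rule L2_F L2_G L2_W0 R zero_L2 | assumption)+
  show "(L2norm M (lift2 M F R (\<lambda>_. 0)))\<^sup>2 \<le> growth_sq" "(L2norm M (lift2 M G R (\<lambda>_. 0)))\<^sup>2 \<le> growth_sq"
    "(L2norm M (lift1 M W0 R))\<^sup>2 \<le> growth_sq"
    using L2_F(2)[OF _ R(1) zero_L2(1)] L2_G(2)[OF _ R(1) zero_L2(1)] L2_W0(2)[OF R(1)] zero_L2(2) k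
    by (auto intro: order_trans)
qed

text \<open>The value at $\theta$ interpolates between the plain monotonicity ($\theta = 0$) and the strong
  one ($\theta = 1$), both taken between $(X_t, W_t)$ and $(\sigma B_t, 0)$.  The coefficients at the
  reference pair are bounded, and Young's inequality moves their contribution into the $\eta$-terms.\<close>

lemma energy_density_ge:
  assumes t: "t \<in> {0..T}" and \<theta>: "0 \<le> \<theta>" "\<theta> \<le> 1" and \<eta>: "0 < \<eta>"
  shows "\<theta> * (\<alpha> * (L2norm M (X' t))\<^sup>2 - L * (L2norm M (W t))\<^sup>2)
      - \<eta> * ((L2norm M (X' t))\<^sup>2 + (L2norm M (W t))\<^sup>2) - growth_sq / \<eta>
    \<le> L2inner M (g t) (X' t) + L2inner M (V t) (f t)"
proof -
  let ?R = "\<lambda>w. \<sigma> *\<^sub>R B t w"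
  let ?F = "lift2 M F ?R (\<lambda>_. 0)" and ?G = "lift2 M G ?R (\<lambda>_. 0)"
  let ?x = "(L2norm M (X' t))\<^sup>2" and ?n = "(L2norm M (W t))\<^sup>2"
  note R = reference_L2(1)[OF t] and ref = reference_coefficients[OF t]
  note XL = XW_L2(1)[OF t] and WL = XW_L2(2)[OF t] and X'L = X'_V_L2(1)[OF t] and fg = drift_L2(1,2)[OF t]
  have XR: "(\<lambda>w. X t w - ?R w) \<in> L2 M" by (rule L2_diff(1)[OF XL R])
  have ae: "AE w in M. X t w - ?R w = X' t w" using X_eq[OF t] by eventually_elim simp
  have nX: "L2norm M (\<lambda>w. X t w - ?R w) = L2norm M (X' t)"
    by (rule L2norm_cong_AE[OF ae L2_measurable[OF XR] L2_measurable[OF X'L]])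
  let ?E = "L2inner M (\<lambda>w. g t w - ?G w) (X' t) + L2inner M (\<lambda>w. f t w - ?F w) (W t)"
  have Eeq: "L2inner M (\<lambda>w. g t w - ?G w) (\<lambda>w. X t w - ?R w)
      + L2inner M (\<lambda>w. f t w - ?F w) (\<lambda>w. W t w - 0) = ?E"
    using L2inner_cong_right[OF ae L2_diff(1)[OF fg(2) ref(3)] XR X'L] by simp
  have E0: "0 \<le> ?E"
    using mono[OF XL R WL zero_L2(1), folded f_def g_def] Eeq by simp
  have E1: "\<alpha> * ?x - L * ?n \<le> ?E"
    using strong_mono[OF XL R WL zero_L2(1), folded f_def g_def] Eeq nX by simp
  have E: "\<theta> * (\<alpha> * ?x - L * ?n) \<le> ?E"
  proof -
    have "\<theta> * (\<alpha> * ?x - L * ?n) \<le> \<theta> * ?E" using E1 \<theta>(1) by (rule mult_left_mono)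
    also have "\<dots> \<le> 1 * ?E" using \<theta>(2) E0 by (rule mult_right_mono)
    finally show ?thesis by simp
  qed
  have Esplit: "?E = L2inner M (g t) (X' t) - L2inner M ?G (X' t)
      + (L2inner M (f t) (W t) - L2inner M ?F (W t))"
    using L2inner_diff_left[OF fg(2) ref(3) X'L] L2inner_diff_left[OF fg(1) ref(1) WL] by simp
  have VW: "L2inner M (f t) (W t) = L2inner M (V t) (f t)"
    using W_inner[OF t f_adapted[OF t] fg(1)] by (simp add: L2inner_commute)
  have y1: "\<bar>L2inner M ?G (X' t)\<bar> \<le> \<eta> * ?x + growth_sq / (4 * \<eta>)"
    using L2inner_Young[OF X'L ref(3) \<eta>] divide_right_mono[OF ref(4), of "4 * \<eta>"] \<eta>
    by (simp add: L2inner_commute[of M ?G])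
  have y2: "\<bar>L2inner M ?F (W t)\<bar> \<le> \<eta> * ?n + growth_sq / (4 * \<eta>)"
    using L2inner_Young[OF WL ref(1) \<eta>] divide_right_mono[OF ref(2), of "4 * \<eta>"] \<eta>
    by (simp add: L2inner_commute[of M ?F])
  have "growth_sq / (4 * \<eta>) + growth_sq / (4 * \<eta>) \<le> growth_sq / \<eta>" using growth_sq_nonneg \<eta> by (simp add: field_simps)
  then show ?thesis using E Esplit VW y1 y2 by (simp add: distrib_left)
qed

text \<open>The same comparison for $\tilde W_0$, between $X_T$ and $\sigma B_T$.\<close>

lemma terminal_ge:
  assumes \<eta>: "0 < \<eta>"
  shows "a0 / 2 * (L2norm M \<omega>)\<^sup>2 - a0 * growth_sq - \<eta> * (L2norm M (X' T))\<^sup>2 - growth_sq / \<eta> \<le> L2inner M \<omega> (X' T)"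
proof -
  have t: "T \<in> {0..T}" using T_pos by simp
  let ?R = "\<lambda>w. \<sigma> *\<^sub>R B T w"
  let ?H = "lift1 M W0 ?R"
  note R = reference_L2(1)[OF t] and ref = reference_coefficients(5,6)[OF t]
  note XL = XW_L2(1)[OF t] and X'L = X'_V_L2(1)[OF t]
  have XR: "(\<lambda>w. X T w - ?R w) \<in> L2 M" by (rule L2_diff(1)[OF XL R])
  have ae: "AE w in M. X T w - ?R w = X' T w" using X_eq[OF t] by eventually_elim simp
  have D: "(\<lambda>w. \<omega> w - ?H w) \<in> L2 M" by (rule L2_diff(1)[OF \<omega>_L2 ref(1)])
  have "a0 * (L2norm M (\<lambda>w. \<omega> w - ?H w))\<^sup>2 \<le> L2inner M (\<lambda>w. \<omega> w - ?H w) (X' T)"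
    using mono_W0[OF XL R] L2inner_cong_right[OF ae D XR X'L] by (simp add: \<omega>_def)
  also have "\<dots> = L2inner M \<omega> (X' T) - L2inner M ?H (X' T)"
    by (rule L2inner_diff_left[OF \<omega>_L2 ref(1) X'L])
  finally have 1: "a0 * (L2norm M (\<lambda>w. \<omega> w - ?H w))\<^sup>2 \<le> L2inner M \<omega> (X' T) - L2inner M ?H (X' T)" .
  have "(L2norm M \<omega>)\<^sup>2 \<le> 2 * (L2norm M (\<lambda>w. \<omega> w - ?H w))\<^sup>2 + 2 * growth_sq"
    using L2_add(2)[OF D ref(1)] ref(2) by simp
  then have "a0 / 2 * (L2norm M \<omega>)\<^sup>2 \<le> a0 / 2 * (2 * (L2norm M (\<lambda>w. \<omega> w - ?H w))\<^sup>2 + 2 * growth_sq)"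
    using a0_pos by (intro mult_left_mono) auto
  then have 2: "a0 / 2 * (L2norm M \<omega>)\<^sup>2 \<le> a0 * (L2norm M (\<lambda>w. \<omega> w - ?H w))\<^sup>2 + a0 * growth_sq"
    by (simp add: algebra_simps)
  have 3: "\<bar>L2inner M ?H (X' T)\<bar> \<le> \<eta> * (L2norm M (X' T))\<^sup>2 + growth_sq / (4 * \<eta>)"
    using L2inner_Young[OF X'L ref(1) \<eta>] divide_right_mono[OF ref(2), of "4 * \<eta>"] \<eta>
    by (simp add: L2inner_commute[of M ?H])
  have "growth_sq / (4 * \<eta>) \<le> growth_sq / \<eta>" using growth_sq_nonneg \<eta> by (simp add: field_simps)
  then show ?thesis using 1 2 3 by linarith
qed

lemma energy:
  "energy_system T \<alpha> L a0 (growth_sq * (1 + a0)) (\<lambda>t. (L2norm M (X' t))\<^sup>2) (\<lambda>t. (L2norm M (W t))\<^sup>2)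
     (\<lambda>t. (L2norm M (f t))\<^sup>2) (\<lambda>t. (L2norm M (g t))\<^sup>2)
     (\<lambda>t. L2inner M (g t) (X' t) + L2inner M (V t) (f t))
     ((L2norm M \<omega>)\<^sup>2) ((L2norm M X0)\<^sup>2) (L2inner M \<omega> (X' T))"
proof -
  have T0: "0 \<le> T" and tT: "0 \<in> {0..T}" using T_pos by auto
  note dual = duality[OF T0 drift_process_L2 \<omega>_L2 X0, folded X'_def V_def, folded X'_def[abs_def] V_def[abs_def]]
  have k: "growth_sq \<le> growth_sq * (1 + a0)" "a0 * growth_sq \<le> growth_sq * (1 + a0)"
    using growth_sq_nonneg a0_pos mult_nonneg_nonneg[of growth_sq a0] by (auto simp: algebra_simps)
  have k\<eta>: "growth_sq / \<eta> \<le> growth_sq * (1 + a0) / \<eta>" if "0 < \<eta>" for \<eta>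
    using k(1) that by (intro divide_right_mono) auto
  have full: "(\<integral>s. indicator {0..T} s *\<^sub>R h s \<partial>horizon T) = (\<integral>s. h s \<partial>horizon T)" for h :: "real \<Rightarrow> real"
    by (intro Bochner_Integration.integral_cong) (auto simp: space_restrict_space)
  show ?thesis
    unfolding energy_system_def
  proof (intro conjI ballI allI impI)
    fix h assume "h \<in> {\<lambda>t. (L2norm M (X' t))\<^sup>2, \<lambda>t. (L2norm M (W t))\<^sup>2,
     \<lambda>t. (L2norm M (f t))\<^sup>2, \<lambda>t. (L2norm M (g t))\<^sup>2,
     \<lambda>t. L2inner M (g t) (X' t) + L2inner M (V t) (f t)}"
    then show "integrable (horizon T) h"
      using process_norm(1)[OF dual(2)] process_norm(1)[OF XW_L2(4)]
        process_norm(1)[OF drift_process_L2(1)] process_norm(1)[OF drift_process_L2(2)] dual(3)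
      by auto
  next
    fix t assume t: "t \<in> {0..T}"
    have "growth_sq * (1 + (L2norm M (X' t))\<^sup>2 + (L2norm M (W t))\<^sup>2)
        \<le> growth_sq * (1 + a0) * (1 + (L2norm M (X' t))\<^sup>2 + (L2norm M (W t))\<^sup>2)"
      using k(1) by (intro mult_right_mono) auto
    then show "(L2norm M (f t))\<^sup>2 \<le> growth_sq * (1 + a0) * (1 + (L2norm M (X' t))\<^sup>2 + (L2norm M (W t))\<^sup>2)"
      "(L2norm M (g t))\<^sup>2 \<le> growth_sq * (1 + a0) * (1 + (L2norm M (X' t))\<^sup>2 + (L2norm M (W t))\<^sup>2)"
      using drift_growth[OF t] by linarith+
    show "(L2norm M (X' t))\<^sup>2 \<le> 2 * (L2norm M X0)\<^sup>2
      + 2 * T * (\<integral>s. indicator {0..t} s *\<^sub>R (L2norm M (f s))\<^sup>2 \<partial>horizon T)"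
      by (rule norm_X'_le[OF t])
    show "(L2norm M (W t))\<^sup>2 \<le> 2 * (L2norm M \<omega>)\<^sup>2
      + 2 * T * (\<integral>s. indicator {t..T} s *\<^sub>R (L2norm M (g s))\<^sup>2 \<partial>horizon T)"
      using norm_W_le_norm_V[OF t] norm_V_le[OF t] by linarith
    fix \<theta> \<eta> :: real assume "\<theta> \<in> {0..1}" "0 < \<eta>"
    then show "\<theta> * (\<alpha> * (L2norm M (X' t))\<^sup>2 - L * (L2norm M (W t))\<^sup>2)
      - \<eta> * ((L2norm M (X' t))\<^sup>2 + (L2norm M (W t))\<^sup>2) - growth_sq * (1 + a0) / \<eta>
      \<le> L2inner M (g t) (X' t) + L2inner M (V t) (f t)"
      using energy_density_ge[OF t, of \<theta> \<eta>] k\<eta>[of \<eta>] by simp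
  next
    fix \<eta> :: real assume \<eta>: "0 < \<eta>"
    show "a0 / 2 * (L2norm M \<omega>)\<^sup>2 - growth_sq * (1 + a0) - \<eta> * (L2norm M (X' T))\<^sup>2 - growth_sq * (1 + a0) / \<eta>
      \<le> L2inner M \<omega> (X' T)"
      using terminal_ge[OF \<eta>] k(2) k\<eta>[OF \<eta>] by linarith
    have "L2inner M \<omega> (X' T) + (\<integral>t. L2inner M (g t) (X' t) + L2inner M (V t) (f t) \<partial>horizon T)
        = L2inner M (V 0) X0"
      by (rule dual(1))
    also have "\<dots> \<le> \<eta> * (L2norm M (V 0))\<^sup>2 + (L2norm M X0)\<^sup>2 / (4 * \<eta>)"
      using L2inner_Young[OF X'_V_L2(2)[OF tT] X0 \<eta>] by simp
    also have "\<dots> \<le> \<eta> * (2 * (L2norm M \<omega>)\<^sup>2 + 2 * T * (\<integral>t. (L2norm M (g t))\<^sup>2 \<partial>horizon T))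
        + (L2norm M X0)\<^sup>2 / \<eta>"
      using norm_V_le[OF tT] \<eta> unfolding full
      by (intro add_mono mult_left_mono divide_left_mono) auto
    finally show "L2inner M \<omega> (X' T) + (\<integral>t. L2inner M (g t) (X' t) + L2inner M (V t) (f t) \<partial>horizon T)
      \<le> \<eta> * (2 * (L2norm M \<omega>)\<^sup>2 + 2 * T * (\<integral>t. (L2norm M (g t))\<^sup>2 \<partial>horizon T))
        + (L2norm M X0)\<^sup>2 / \<eta>" .
  qed auto
qed

text \<open>The drift contributes a term of order $(t - s)^2$ to the squared norm, the noise one of order
  $t - s$.\<close>

lemma increment_bound:
  assumes st: "0 \<le> s" "s < t" "t \<le> T"
    and K: "\<And>r. r \<in> {0..T} \<Longrightarrow> (L2norm M (f r))\<^sup>2 \<le> K"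
  shows "(L2norm M (\<lambda>w. X t w - X s w))\<^sup>2 \<le> (t - s) * (2 * T * K + 2 * \<sigma>\<^sup>2 * real CARD('n))"
proof -
  have s: "s \<in> {0..T}" and t: "t \<in> {0..T}" using st by auto
  let ?I = "\<lambda>w. \<integral>r. indicator {s<..t} r *\<^sub>R f r w \<partial>horizon T"
  let ?D = "\<lambda>w. \<sigma> *\<^sub>R (B t w - B s w)"
  have S: "{s<..t} \<in> sets (horizon T)" "measure (horizon T) {s<..t} = t - s"
    using st by (auto simp: measure_horizon)
  note I = time_integral_L2[OF drift_process_L2(1) S(1)]
  note D = L2_scaleR[OF increment_moments(3)[OF st], of \<sigma>]
  have K0: "0 \<le> K" using K[OF s] by (rule order_trans[OF zero_le_power2])
  have "AE w in M. X t w - X s w = ?D w - ?I w"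
    using X_eq[OF s] X_eq[OF t] process_norm(2)[OF drift_process_L2(1)]
  proof eventually_elim
    case (elim w)
    have i: "integrable (horizon T) (\<lambda>r. indicator {0..u} r *\<^sub>R f r w)" if "u \<in> {0..T}" for u
      using that by (intro norm_integral_indicator_power2_le(2)[OF elim(3)] measure_horizon) auto
    have "?I w = (\<integral>r. indicator {0..t} r *\<^sub>R f r w - indicator {0..s} r *\<^sub>R f r w \<partial>horizon T)"
      using st by (intro Bochner_Integration.integral_cong)
        (auto simp: space_restrict_space split: split_indicator)
    also have "\<dots> = X' s w - X' t w"
      using i[OF s] i[OF t] by (simp add: X'_def)
    finally show ?case using elim(1,2) by (simp add: scaleR_diff_right)
  qed
  then have "L2norm M (\<lambda>w. X t w - X s w) = L2norm M (\<lambda>w. ?D w - ?I w)"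
    by (rule L2norm_cong_AE)
      (use L2_measurable[OF L2_diff(1)[OF XW_L2(1)[OF t] XW_L2(1)[OF s]]]
        L2_measurable[OF L2_diff(1)[OF D I(1)]] in auto)
  then have "(L2norm M (\<lambda>w. X t w - X s w))\<^sup>2 \<le> 2 * (L2norm M ?D)\<^sup>2 + 2 * (L2norm M ?I)\<^sup>2"
    using L2_diff(2)[OF D I(1)] by simp
  moreover have "(L2norm M ?D)\<^sup>2 = \<sigma>\<^sup>2 * (real CARD('n) * (t - s))"
    using increment_moments(4)[OF st] by (simp add: L2norm_scaleR power_mult_distrib)
  moreover have "(L2norm M ?I)\<^sup>2 \<le> (t - s) * (T * K)"
  proof -
    have "(\<integral>r. indicator {s<..t} r * (L2norm M (f r))\<^sup>2 \<partial>horizon T) \<le> (\<integral>r. K \<partial>horizon T)"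
    proof (rule integral_mono)
      have fi: "integrable (horizon T) (\<lambda>r. (L2norm M (f r))\<^sup>2)"
        by (rule process_norm(1)[OF drift_process_L2(1)])
      have [measurable]: "(\<lambda>r. (L2norm M (f r))\<^sup>2) \<in> borel_measurable (horizon T)"
        using fi by (rule borel_measurable_integrable)
      show "integrable (horizon T) (\<lambda>r. indicator {s<..t} r * (L2norm M (f r))\<^sup>2)"
        by (rule Bochner_Integration.integrable_bound[OF fi]) (measurable, auto split: split_indicator)
      show "indicator {s<..t} r * (L2norm M (f r))\<^sup>2 \<le> K" if "r \<in> space (horizon T)" for r
        using that K[of r] K0 by (auto simp: space_restrict_space split: split_indicator)
    qed simp
    also have "\<dots> = T * K" using T_pos by (intro integral_const_horizon) simp
    finally show ?thesis
      using I(2) st unfolding S(2) by (elim order_trans) (intro mult_left_mono, auto)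
  qed
  ultimately show ?thesis by (simp add: algebra_simps)
qed

end

theorem lemma3p14:
  fixes T \<sigma> \<alpha> L a0 C1 :: real
  assumes "T > 0" and "\<sigma> \<ge> 0" and "\<alpha> > 0" and "L \<ge> 0" and "a0 > 0"
  shows "\<exists>C. \<forall>(M :: 'w measure) Fil (B :: real \<Rightarrow> 'w \<Rightarrow> real ^ 'n)
      (W0 :: real ^ 'n \<Rightarrow> (real ^ 'n) measure \<Rightarrow> real ^ 'n)
      (F :: real ^ 'n \<Rightarrow> (real ^ 'n) measure \<Rightarrow> real ^ 'n \<Rightarrow> real ^ 'n)
      (G :: real ^ 'n \<Rightarrow> (real ^ 'n) measure \<Rightarrow> real ^ 'n \<Rightarrow> real ^ 'n)
      X0 X W Z.
    rich_space M \<and> brownian_motion M Fil T B \<and>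
    W2_continuous W0 \<and>
    W2_continuous (\<lambda>(x, u) \<mu>. F x \<mu> u) \<and>
    W2_continuous (\<lambda>(x, u) \<mu>. G x \<mu> u) \<and>
    (\<forall>x u. \<forall>\<mu>\<in>P2. norm (W0 x \<mu>) + norm (F x \<mu> u) + norm (G x \<mu> u)
        \<le> C1 * (1 + norm x + norm u + sqrt (E2 \<mu>))) \<and>
    (\<forall>X\<in>L2 M. \<forall>Y\<in>L2 M.
        L2inner M (\<lambda>w. lift1 M W0 X w - lift1 M W0 Y w) (\<lambda>w. X w - Y w)
          \<ge> a0 * (L2norm M (\<lambda>w. lift1 M W0 X w - lift1 M W0 Y w))\<^sup>2) \<and>
    (\<forall>X\<in>L2 M. \<forall>Y\<in>L2 M. \<forall>U\<in>L2 M. \<forall>V\<in>L2 M.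
        L2inner M (\<lambda>w. lift2 M G X U w - lift2 M G Y V w) (\<lambda>w. X w - Y w)
          + L2inner M (\<lambda>w. lift2 M F X U w - lift2 M F Y V w) (\<lambda>w. U w - V w) \<ge> 0) \<and>
    (\<forall>X\<in>L2 M. \<forall>Y\<in>L2 M. \<forall>U\<in>L2 M. \<forall>V\<in>L2 M.
        L2inner M (\<lambda>w. lift2 M G X U w - lift2 M G Y V w) (\<lambda>w. X w - Y w)
          + L2inner M (\<lambda>w. lift2 M F X U w - lift2 M F Y V w) (\<lambda>w. U w - V w)
          \<ge> \<alpha> * (L2norm M (\<lambda>w. X w - Y w))\<^sup>2 - L * (L2norm M (\<lambda>w. U w - V w))\<^sup>2) \<and>
    X0 \<in> L2 M \<and> X0 \<in> borel_measurable (Fil 0) \<and>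
    strong_solution M Fil B T \<sigma> W0 F G X0 X W Z
    \<longrightarrow>
    (\<forall>t\<in>{0..T}. L2norm M (X t) \<le> C * (1 + L2norm M X0) \<and>
                L2norm M (W t) \<le> C * (1 + L2norm M X0)) \<and>
    (\<forall>s t. 0 \<le> s \<and> s < t \<and> t \<le> T \<longrightarrow>
       L2norm M (\<lambda>w. X t w - X s w) / sqrt (t - s) \<le> C * (1 + L2norm M X0))"
proof -
  define b where "b = \<sigma>\<^sup>2 * (real CARD('n) * T)"
  define k1 where "k1 = 16 * C1\<^sup>2 * (1 + b)"
  define k where "k = k1 * (1 + a0)"
  have b0: "0 \<le> b" and k1: "0 \<le> k1" and k: "0 \<le> k"
    using assms by (auto simp: b_def k1_def k_def)
  obtain R where R: "0 \<le> R"
    and bound: "\<And>x n \<phi> \<gamma> e A x0 D t. energy_system T \<alpha> L a0 k x n \<phi> \<gamma> e A x0 D \<Longrightarrow> t \<in> {0..T} \<Longrightarrow>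
      x t \<le> R * (1 + x0) \<and> n t \<le> R * (1 + x0)"
    using a_priori_bound[OF assms(1,3,4,5) k] by blast
  \<comment> \<open>The square of the constant: $2R + 2b$ serves $X_t$ and $W_t$, the other terms serve the
    increments.\<close>
  define S where "S = 2 * R + 2 * b + 2 * T * (k1 * (1 + 2 * R)) + 2 * \<sigma>\<^sup>2 * real CARD('n)"
  have S: "0 \<le> S" "R \<le> S" "2 * R + 2 * b \<le> S"
    "2 * T * (k1 * (1 + 2 * R)) + 2 * \<sigma>\<^sup>2 * real CARD('n) \<le> S"
  proof -
    have "0 \<le> 2 * T * (k1 * (1 + 2 * R))" "0 \<le> 2 * \<sigma>\<^sup>2 * real CARD('n)"
      using assms k1 R by auto
    then show "0 \<le> S" "R \<le> S" "2 * R + 2 * b \<le> S"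
      "2 * T * (k1 * (1 + 2 * R)) + 2 * \<sigma>\<^sup>2 * real CARD('n) \<le> S"
      using R b0 unfolding S_def by linarith+
  qed
  have root: "y \<le> sqrt S * (1 + z)" if "y\<^sup>2 \<le> S * (1 + z\<^sup>2)" "0 \<le> z" for y z :: real
  proof (rule power2_le_imp_le)
    have "1 + z\<^sup>2 \<le> (1 + z)\<^sup>2" using that(2) by (simp add: power2_eq_square algebra_simps)
    then have "S * (1 + z\<^sup>2) \<le> S * (1 + z)\<^sup>2" using S(1) by (rule mult_left_mono)
    then show "y\<^sup>2 \<le> (sqrt S * (1 + z))\<^sup>2" using that(1) S(1) by (simp add: power_mult_distrib)
    show "0 \<le> sqrt S * (1 + z)" using S(1) that(2) by simp
  qed
  show ?thesis
  proof (intro exI[of _ "sqrt S"] allI impI, elim conjE)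
    fix M :: "'w measure" and Fil and B :: "real \<Rightarrow> 'w \<Rightarrow> real ^ 'n"
      and W0 :: "real ^ 'n \<Rightarrow> (real ^ 'n) measure \<Rightarrow> real ^ 'n"
      and F G :: "real ^ 'n \<Rightarrow> (real ^ 'n) measure \<Rightarrow> real ^ 'n \<Rightarrow> real ^ 'n"
      and X0 X W Z
    assume bm: "brownian_motion M Fil T B"
      and c: "W2_continuous W0" "W2_continuous (\<lambda>(x, u) \<mu>. F x \<mu> u)"
        "W2_continuous (\<lambda>(x, u) \<mu>. G x \<mu> u)"
      and gr: "\<forall>x u. \<forall>\<mu>\<in>P2. norm (W0 x \<mu>) + norm (F x \<mu> u) + norm (G x \<mu> u)
        \<le> C1 * (1 + norm x + norm u + sqrt (E2 \<mu>))"
      and m0: "\<forall>X\<in>L2 M. \<forall>Y\<in>L2 M.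
        L2inner M (\<lambda>w. lift1 M W0 X w - lift1 M W0 Y w) (\<lambda>w. X w - Y w)
          \<ge> a0 * (L2norm M (\<lambda>w. lift1 M W0 X w - lift1 M W0 Y w))\<^sup>2"
      and m1: "\<forall>X\<in>L2 M. \<forall>Y\<in>L2 M. \<forall>U\<in>L2 M. \<forall>V\<in>L2 M.
        L2inner M (\<lambda>w. lift2 M G X U w - lift2 M G Y V w) (\<lambda>w. X w - Y w)
          + L2inner M (\<lambda>w. lift2 M F X U w - lift2 M F Y V w) (\<lambda>w. U w - V w) \<ge> 0"
      and m2: "\<forall>X\<in>L2 M. \<forall>Y\<in>L2 M. \<forall>U\<in>L2 M. \<forall>V\<in>L2 M.
        L2inner M (\<lambda>w. lift2 M G X U w - lift2 M G Y V w) (\<lambda>w. X w - Y w)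
          + L2inner M (\<lambda>w. lift2 M F X U w - lift2 M F Y V w) (\<lambda>w. U w - V w)
          \<ge> \<alpha> * (L2norm M (\<lambda>w. X w - Y w))\<^sup>2 - L * (L2norm M (\<lambda>w. U w - V w))\<^sup>2"
      and x: "X0 \<in> L2 M" and sol: "strong_solution M Fil B T \<sigma> W0 F G X0 X W Z"
    interpret bm: brownian_motion M Fil T B by (rule bm)
    interpret sys: monotone_system M Fil T B \<sigma> \<alpha> L a0 C1 W0 F G X0 X W Z
      by unfold_locales (use assms c gr m0 m1 m2 x sol in blast)+
    have const: "sys.noise_sq = b" "sys.growth_sq = k1"
      by (simp_all add: sys.noise_sq_def sys.growth_sq_def b_def k1_def)
    let ?x0 = "L2norm M X0"
    have main: "(L2norm M (sys.X' t))\<^sup>2 \<le> R * (1 + ?x0\<^sup>2)" "(L2norm M (W t))\<^sup>2 \<le> R * (1 + ?x0\<^sup>2)"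
      if "t \<in> {0..T}" for t
      using bound[OF sys.energy[unfolded const, folded k_def] that] by auto
    have absorb: "y + z * (1 + ?x0\<^sup>2) \<le> S * (1 + ?x0\<^sup>2)" if "z + y \<le> S" "0 \<le> y" for y z
    proof -
      have "y + z * (1 + ?x0\<^sup>2) \<le> (z + y) * (1 + ?x0\<^sup>2)" using that(2) by (simp add: algebra_simps)
      also have "\<dots> \<le> S * (1 + ?x0\<^sup>2)" using that(1) by (intro mult_right_mono) auto
      finally show ?thesis .
    qed
    have X: "L2norm M (X t) \<le> sqrt S * (1 + ?x0)" if t: "t \<in> {0..T}" for t
    proof (rule root)
      have "(L2norm M (X t))\<^sup>2 \<le> 2 * b + 2 * R * (1 + ?x0\<^sup>2)"
        using sys.norm_X_le[OF t] main(1)[OF t] unfolding const by simp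
      also have "\<dots> \<le> S * (1 + ?x0\<^sup>2)" using S(3) b0 by (intro absorb) auto
      finally show "(L2norm M (X t))\<^sup>2 \<le> S * (1 + ?x0\<^sup>2)" .
    qed simp
    have W: "L2norm M (W t) \<le> sqrt S * (1 + ?x0)" if t: "t \<in> {0..T}" for t
      using main(2)[OF t] absorb[of R 0] S(2) by (intro root) auto
    have incr: "L2norm M (\<lambda>w. X t w - X s w) / sqrt (t - s) \<le> sqrt S * (1 + ?x0)"
      if st: "0 \<le> s" "s < t" "t \<le> T" for s t
    proof (rule root)
      define K where "K = k1 * (1 + 2 * R * (1 + ?x0\<^sup>2))"
      have K: "(L2norm M (sys.f r))\<^sup>2 \<le> K" if r: "r \<in> {0..T}" for r
      proof -
        have "(L2norm M (sys.f r))\<^sup>2 \<le> k1 * (1 + (L2norm M (sys.X' r))\<^sup>2 + (L2norm M (W r))\<^sup>2)"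
          using sys.drift_growth(1)[OF r] unfolding const .
        also have "\<dots> \<le> K"
          unfolding K_def using main[OF r] k1 by (intro mult_left_mono) auto
        finally show ?thesis .
      qed
      have "(L2norm M (\<lambda>w. X t w - X s w))\<^sup>2
          \<le> (t - s) * ((2 * T * k1 + 2 * \<sigma>\<^sup>2 * real CARD('n)) + 2 * T * (k1 * (2 * R)) * (1 + ?x0\<^sup>2))"
        using sys.increment_bound[OF st K] by (simp add: K_def algebra_simps)
      also have "\<dots> \<le> (t - s) * (S * (1 + ?x0\<^sup>2))"
        using st S(4) k1 assms
        by (intro mult_left_mono absorb) (simp_all add: algebra_simps)
      finally have "(L2norm M (\<lambda>w. X t w - X s w))\<^sup>2 / (t - s) \<le> S * (1 + ?x0\<^sup>2)"
        using st by (simp add: pos_divide_le_eq mult.commute)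
      then show "(L2norm M (\<lambda>w. X t w - X s w) / sqrt (t - s))\<^sup>2 \<le> S * (1 + ?x0\<^sup>2)"
        using st by (simp add: power_divide)
    qed simp
    show "(\<forall>t\<in>{0..T}. L2norm M (X t) \<le> sqrt S * (1 + ?x0) \<and> L2norm M (W t) \<le> sqrt S * (1 + ?x0)) \<and>
      (\<forall>s t. 0 \<le> s \<and> s < t \<and> t \<le> T \<longrightarrow>
        L2norm M (\<lambda>w. X t w - X s w) / sqrt (t - s) \<le> sqrt S * (1 + ?x0))"
      using X W incr by blast
  qed
qed

end
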